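(* For any irrational number $\alpha\in\mathbb{R}$ there exist a commutative perturbation $\mathcal{S}$ and a non-commutative perturbation $\mathcal{R}$ such that the operators $$\mathcal{L}_{\mathcal{S}}=D_t+\alpha D_x+\mathcal{S}\qquad\text{and}\qquad \mathcal{L}_{\mathcal{R}}=D_t+\alpha D_x+\mathcal{R}$$ are not globally hypoelliptic on $\mathbb{T}^2$.
   Context: Here $\mathbb{N}=\{1,2,\dots\}$, $\mathbb{T}\simeq\mathbb{R}/2\pi\mathbb{Z}$, $(t,x)\in\mathbb{T}^2$, $D_t=-i\,\partial/\partial t$, $D_x=-i\,\partial/\partial x$. An operator $L$ is globally hypoelliptic on $\mathbb{T}^2$ if $u\in\mathcal{D}'(\mathbb{T}^2)$ and $Lu\in C^\infty(\mathbb{T}^2)$ imply $u\in C^\infty(\mathbb{T}^2)$. Let $E=-D_x^2$ be the operator printed in this setting, with eigenspaces $E_0=\mathbb{C}$ (constants) and $E_{j^2}=\mathrm{span}\{e_j^1,e_j^2\}$, $j\in\mathbb{N}$, where $e_j^1(x)=e^{-ijx}$, $e_j^2(x)=e^{ijx}$ (only these eigenspaces matter). A perturbation is an operator $\mathcal{R}$ on $\mathcal{D}'(\mathbb{T})$, acting on distributions on $\mathbb{T}^2$ in the variable $x$, which leaves each of these eigenspaces invariant, is zero on $E_0$, and acts on $E_{j^2}$, in the basis $\{e_j^1,e_j^2\}$, by the matrix $$\mathcal{R}_j=\begin{pmatrix} r_j&\gamma_j\\ \gamma_j& r_j\end{pmatrix}\in\mathbb{R}^{2\times2},\quad j\in\mathbb{N},$$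 where $\|\mathcal{R}_j\|=\mathcal{O}(j^{\delta})$ as $j\to\infty$ for some $0\le\delta<1$. The perturbation $\mathcal{R}$ is called commutative if $[D_x,\mathcal{R}]=0$ (equivalently $\gamma_j=0$ for all $j$), and non-commutative otherwise. *)

theory Defs
  imports "HOL-Analysis.Analysis" "HOL-Library.Landau_Symbols"
begin

text \<open>
  The torus is represented by a Euclidean space \<^typ>\<open>'a\<close> modulo the lattice spanned by the vectors
  \<open>2 * pi *\<^sub>R b\<close>, \<open>b \<in> Basis\<close>: the type \<^typ>\<open>real\<close> gives the one-dimensional torus, with variable
  \<open>x\<close>, and \<^typ>\<open>real \<times> real\<close> gives the two-dimensional one, with variables \<open>(t, x)\<close>.
\<close>

definition partial_deriv :: "'a::euclidean_space \<Rightarrow> ('a \<Rightarrow> complex) \<Rightarrow> 'a \<Rightarrow> complex" where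
  "partial_deriv b f = (\<lambda>p. frechet_derivative f (at p) b)"

definition iter_partial :: "'a::euclidean_space list \<Rightarrow> ('a \<Rightarrow> complex) \<Rightarrow> 'a \<Rightarrow> complex" where
  "iter_partial bs f = foldr partial_deriv bs f"

definition smooth_fun :: "('a::euclidean_space \<Rightarrow> complex) \<Rightarrow> bool" where
  "smooth_fun f \<longleftrightarrow> (\<forall>bs\<in>lists Basis. \<forall>p. iter_partial bs f differentiable (at p))"

definition periodic_fun :: "('a::euclidean_space \<Rightarrow> complex) \<Rightarrow> bool" where
  "periodic_fun f \<longleftrightarrow> (\<forall>b\<in>Basis. \<forall>p. f (p + (2 * pi) *\<^sub>R b) = f p)"

definition Cinf :: "('a::euclidean_space \<Rightarrow> complex) set" where
  "Cinf = {f. periodic_fun f \<and> smooth_fun f}"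

type_synonym 'a functional = "('a \<Rightarrow> complex) \<Rightarrow> complex"

definition Cinf_norm :: "nat \<Rightarrow> ('a::euclidean_space \<Rightarrow> complex) \<Rightarrow> real" where
  "Cinf_norm N f = (\<Sum>bs\<in>{bs \<in> lists Basis. length bs \<le> N}. SUP p. norm (iter_partial bs f p))"

text \<open>
  Distributions are the continuous linear functionals on \<^term>\<open>Cinf\<close>. They are taken to be
  extensional (\<^term>\<open>undefined\<close> outside of \<^term>\<open>Cinf\<close>), so that equality of distributions is
  equality on all test functions.
\<close>
definition distributions :: "'a::euclidean_space functional set" where
  "distributions = {u \<in> extensional Cinf.
     (\<forall>\<phi>\<in>Cinf. \<forall>\<psi>\<in>Cinf. u (\<lambda>p. \<phi> p + \<psi> p) = u \<phi> + u \<psi>) \<and>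
     (\<forall>c. \<forall>\<phi>\<in>Cinf. u (\<lambda>p. c * \<phi> p) = c * u \<phi>) \<and>
     (\<exists>C N. \<forall>\<phi>\<in>Cinf. norm (u \<phi>) \<le> C * Cinf_norm N \<phi>)}"

definition dist_of :: "('a::euclidean_space \<Rightarrow> complex) \<Rightarrow> 'a functional" where
  "dist_of f = (\<lambda>\<phi>\<in>Cinf. integral (cbox 0 ((2 * pi) *\<^sub>R One)) (\<lambda>p. f p * \<phi> p))"

definition dirac :: "'a::euclidean_space \<Rightarrow> 'a functional" where
  "dirac p = (\<lambda>\<phi>\<in>Cinf. \<phi> p)"

text \<open>
  The operator \<open>D = -i \<partial>\<close> in the direction \<open>b\<close>. The minus sign of the transposed derivative
  and the factor \<open>-i\<close> combine to \<open>i\<close>.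
\<close>
definition D_op :: "'a::euclidean_space \<Rightarrow> 'a functional \<Rightarrow> 'a functional" where
  "D_op b u = (\<lambda>\<phi>\<in>Cinf. u (\<lambda>p. \<i> * partial_deriv b \<phi> p))"

text \<open>
  Continuous linear operators on the distributions on the one-dimensional torus. For linear
  operators on this space (the dual of a nuclear Frechet space) continuity is the same as
  sequential continuity for pointwise convergence on test functions.
\<close>
definition dist_operator :: "(real functional \<Rightarrow> real functional) \<Rightarrow> bool" where
  "dist_operator R \<longleftrightarrow>
     (\<forall>v\<in>distributions. R v \<in> distributions) \<and>
     (\<forall>v\<in>distributions. \<forall>w\<in>distributions. \<forall>\<phi>\<in>Cinf.
        R (\<lambda>\<psi>\<in>Cinf. v \<psi> + w \<psi>) \<phi> = R v \<phi> + R w \<phi>) \<and>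
     (\<forall>c. \<forall>v\<in>distributions. \<forall>\<phi>\<in>Cinf. R (\<lambda>\<psi>\<in>Cinf. c * v \<psi>) \<phi> = c * R v \<phi>) \<and>
     (\<forall>V. \<forall>v\<in>distributions. (\<forall>n::nat. V n \<in> distributions) \<longrightarrow>
        (\<forall>\<phi>\<in>Cinf. (\<lambda>n. V n \<phi>) \<longlonglongrightarrow> v \<phi>) \<longrightarrow>
        (\<forall>\<phi>\<in>Cinf. (\<lambda>n. R (V n) \<phi>) \<longlonglongrightarrow> R v \<phi>))"

definition e1 :: "nat \<Rightarrow> real functional" where
  "e1 j = dist_of (\<lambda>x. exp (- \<i> * of_nat j * of_real x))"

definition e2 :: "nat \<Rightarrow> real functional" where
  "e2 j = dist_of (\<lambda>x. exp (\<i> * of_nat j * of_real x))"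

definition pert_matrix :: "real \<Rightarrow> real \<Rightarrow> real^2^2" where
  "pert_matrix r g = vector [vector [r, g], vector [g, r]]"

text \<open>
  The two equations for \<^term>\<open>R (e1 j)\<close> and \<^term>\<open>R (e2 j)\<close> say that \<^term>\<open>R\<close> leaves the span
  of \<^term>\<open>e1 j\<close> and \<^term>\<open>e2 j\<close> invariant and acts there by \<^term>\<open>pert_matrix (r j) (\<gamma> j)\<close>.
\<close>
definition perturbation :: "(real functional \<Rightarrow> real functional) \<Rightarrow> bool" where
  "perturbation R \<longleftrightarrow>
     dist_operator R \<and>
     (\<forall>\<phi>\<in>Cinf. R (dist_of (\<lambda>_. 1)) \<phi> = 0) \<and>
     (\<exists>r \<gamma> :: nat \<Rightarrow> real. \<exists>\<delta>::real.
        (\<forall>j\<ge>1. \<forall>\<phi>\<in>Cinf.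
           R (e1 j) \<phi> = of_real (r j) * e1 j \<phi> + of_real (\<gamma> j) * e2 j \<phi> \<and>
           R (e2 j) \<phi> = of_real (\<gamma> j) * e1 j \<phi> + of_real (r j) * e2 j \<phi>) \<and>
        0 \<le> \<delta> \<and> \<delta> < 1 \<and>
        (\<lambda>j. onorm ((*v) (pert_matrix (r j) (\<gamma> j)))) \<in> O(\<lambda>j. real j powr \<delta>))"

definition commutative :: "(real functional \<Rightarrow> real functional) \<Rightarrow> bool" where
  "commutative R \<longleftrightarrow> (\<forall>v\<in>distributions. D_op 1 (R v) = R (D_op 1 v))"

text \<open>
  The action in the variable \<open>x\<close>, by transposition. The transpose of a continuous operator
  \<^term>\<open>R\<close> maps a test function \<open>\<phi>\<close> on the circle to the test function whose value at \<open>x\<close> is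
  \<^term>\<open>dirac x\<close> applied to it, that is \<^term>\<open>R (dirac x) \<phi>\<close>. Applied to \<open>\<Phi>(t, \<cdot>)\<close> for each
  \<open>t\<close>, it gives the transpose of the operator \<open>1 \<otimes> R\<close> on distributions in \<open>(t, x)\<close>.
\<close>
definition transpose_op :: "(real functional \<Rightarrow> real functional) \<Rightarrow> (real \<Rightarrow> complex) \<Rightarrow> real \<Rightarrow> complex" where
  "transpose_op R \<phi> = (\<lambda>x. R (dirac x) \<phi>)"

definition act_in_x :: "(real functional \<Rightarrow> real functional) \<Rightarrow>
    (real \<times> real) functional \<Rightarrow> (real \<times> real) functional" where
  "act_in_x R u = (\<lambda>\<Phi>\<in>Cinf. u (\<lambda>(t, x). transpose_op R (\<lambda>y. \<Phi> (t, y)) x))"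

definition L_op :: "real \<Rightarrow> (real functional \<Rightarrow> real functional) \<Rightarrow>
    (real \<times> real) functional \<Rightarrow> (real \<times> real) functional" where
  "L_op \<alpha> R u =
     (\<lambda>\<Phi>\<in>Cinf. D_op (1, 0) u \<Phi> + of_real \<alpha> * D_op (0, 1) u \<Phi> + act_in_x R u \<Phi>)"

definition globally_hypoelliptic ::
    "((real \<times> real) functional \<Rightarrow> (real \<times> real) functional) \<Rightarrow> bool" where
  "globally_hypoelliptic L \<longleftrightarrow>
     (\<forall>u\<in>distributions. L u \<in> dist_of ` Cinf \<longrightarrow> u \<in> dist_of ` Cinf)"

end

theory Submission
  imports Defs
begin

text \<open>
  Both perturbations are Fourier multipliers in \<open>x\<close> combined with the reflection \<open>x \<mapsto> -x\<close>. Given real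
  sequences \<open>r\<close>, \<open>g\<close> with \<open>\<Sum> \<bar>r j\<bar>\<close> and \<open>\<Sum> \<bar>g j\<bar>\<close> finite and \<open>r 0 = g 0 = 0\<close>, let \<open>K\<close> and \<open>H\<close> be the even
  continuous functions \<open>\<Sum> r j / pi * cos (j y)\<close> and \<open>\<Sum> g j / pi * cos (j y)\<close>. The map that
  takes \<open>f\<close> to its convolution with \<open>K\<close> plus the reflection of its convolution with \<open>H\<close> preserves the
  smooth periodic functions and is bounded in each of the
  norms that define distributions, so its transpose is a continuous operator on distributions. On the
  span of \<open>e1 j\<close> and \<open>e2 j\<close> it has diagonal entries \<open>r j\<close> and off-diagonal entries \<open>g j\<close>
  (\<open>perturbation_sym_op\<close>). It commutes with the derivative if \<open>g = 0\<close>, and does not if \<open>g 1 \<noteq> 0\<close>.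

  By Dirichlet's theorem there is a sparse sequence of frequencies \<open>m k \<ge> 4 ^ Suc k\<close> at which \<open>\<alpha> * m k\<close> is
  within \<open>(1 / 2) ^ k\<close> of its nearest integer (\<open>sparse_approx\<close>). Take \<open>r j\<close> to be that integer minus
  \<open>\<alpha> * j\<close> at these frequencies and \<open>0\<close> elsewhere, a summable sequence. With \<open>\<tau> j\<close> minus the nearest
  integer, \<open>\<tau> j + \<alpha> * j + r j = 0\<close> on the sparse set, so each wave \<open>exp (\<i> (\<tau> j t + j x))\<close> is in the kernel
  of the operator, as long as \<open>g\<close> vanishes at these frequencies. The superposition of these waves with
  coefficients \<open>1 / sqrt j\<close> converges uniformly, since the frequencies grow geometrically, and is also in
  the kernel; but \<open>j\<close> times its \<open>j\<close>-th coefficient is unbounded, whereas a smooth function has Fourier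
  coefficients \<open>O(1/j)\<close>. So the operator is not globally hypoelliptic
  (\<open>not_globally_hypoelliptic_sym_op\<close>). The commutative perturbation has \<open>g = 0\<close>; the non-commutative one
  has \<open>g j = 0\<close> except for \<open>g 1 = 1\<close>, which is harmless because \<open>1\<close> is not one of the frequencies.
\<close>

section \<open>Smooth periodic functions\<close>

lemma iter_partial_simps [simp]:
  "iter_partial [] f = f"
  "iter_partial (b # bs) f = partial_deriv b (iter_partial bs f)"
  by (simp_all add: iter_partial_def)

lemma iter_partial_snoc: "iter_partial (bs @ [b]) f = iter_partial bs (partial_deriv b f)"
  by (simp add: iter_partial_def)

lemma partial_deriv_eq:
  assumes "\<And>p. (f has_derivative f' p) (at p)"
  shows "partial_deriv b f = (\<lambda>p. f' p b)"
  using frechet_derivative_at[OF assms, symmetric] by (simp add: partial_deriv_def)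

text \<open>Smoothness is shown by exhibiting a class of differentiable functions that is closed under
  partial derivatives.\<close>
lemma smooth_fun_coinduct:
  assumes "f \<in> X"
    and "\<And>g p. g \<in> X \<Longrightarrow> g differentiable (at p)"
    and "\<And>g b. g \<in> X \<Longrightarrow> b \<in> Basis \<Longrightarrow> partial_deriv b g \<in> X"
  shows "smooth_fun f"
proof -
  have "iter_partial bs f \<in> X" if "bs \<in> lists Basis" for bs
    using that by induction (auto simp: assms)
  then show ?thesis
    unfolding smooth_fun_def using assms(2) by blast
qed

lemma Cinf_differentiable: "f \<in> Cinf \<Longrightarrow> f differentiable (at p)"
  unfolding Cinf_def smooth_fun_def by (auto dest: bspec[where x="[]"])

lemma Cinf_has_derivative: "f \<in> Cinf \<Longrightarrow> (f has_derivative frechet_derivative f (at p)) (at p)"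
  using Cinf_differentiable frechet_derivative_works by blast

lemma Cinf_continuous: "f \<in> Cinf \<Longrightarrow> continuous_on A f"
  using Cinf_differentiable
  by (meson differentiable_imp_continuous_on differentiable_on_def differentiable_at_withinI)

lemma Cinf_periodic: "f \<in> Cinf \<Longrightarrow> b \<in> Basis \<Longrightarrow> f (p + (2 * pi) *\<^sub>R b) = f p"
  by (auto simp: Cinf_def periodic_fun_def)

lemma Cinf_partial_deriv:
  assumes f: "f \<in> Cinf" and b: "b \<in> Basis"
  shows "partial_deriv b f \<in> Cinf"
proof -
  have "partial_deriv b f (p + (2 * pi) *\<^sub>R c) = partial_deriv b f p" if c: "c \<in> Basis" for c p
  proof -
    have "((\<lambda>q. q + (2 * pi) *\<^sub>R c) has_derivative (\<lambda>h. h)) (at p)"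
      by (auto intro!: derivative_eq_intros)
    then have "((\<lambda>q. f (q + (2 * pi) *\<^sub>R c)) has_derivative
        frechet_derivative f (at (p + (2 * pi) *\<^sub>R c))) (at p)"
      by (rule has_derivative_compose) (rule Cinf_has_derivative[OF f])
    then have "(f has_derivative frechet_derivative f (at (p + (2 * pi) *\<^sub>R c))) (at p)"
      using Cinf_periodic[OF f c] by simp
    from frechet_derivative_at[OF this] show ?thesis
      by (simp add: partial_deriv_def)
  qed
  moreover have "smooth_fun (partial_deriv b f)"
    unfolding smooth_fun_def
  proof (intro ballI allI)
    fix bs p assume "bs \<in> lists (Basis :: 'a set)"
    then have "bs @ [b] \<in> lists Basis" using b by auto
    with f show "iter_partial bs (partial_deriv b f) differentiable (at p)"
      unfolding Cinf_def smooth_fun_def iter_partial_snoc[symmetric] by blast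
  qed
  ultimately show ?thesis
    by (simp add: Cinf_def periodic_fun_def)
qed

lemma Cinf_iter_partial: "f \<in> Cinf \<Longrightarrow> bs \<in> lists Basis \<Longrightarrow> iter_partial bs f \<in> Cinf"
  by (induction bs) (auto intro: Cinf_partial_deriv)

text \<open>The analogous criterion for membership in \<^term>\<open>Cinf\<close>.\<close>
lemma CinfI:
  assumes "f \<in> X"
    and "\<And>g b p. g \<in> X \<Longrightarrow> b \<in> Basis \<Longrightarrow> g (p + (2 * pi) *\<^sub>R b) = g p"
    and "\<And>g p. g \<in> X \<Longrightarrow> g differentiable (at p)"
    and "\<And>g b. g \<in> X \<Longrightarrow> b \<in> Basis \<Longrightarrow> partial_deriv b g \<in> X"
  shows "f \<in> Cinf"
  using assms smooth_fun_coinduct[of f X] by (auto simp: Cinf_def periodic_fun_def)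

lemma Cinf_add:
  assumes "f \<in> Cinf" "g \<in> Cinf"
  shows "(\<lambda>p. f p + g p) \<in> Cinf"
proof (rule CinfI[where X="{\<lambda>p. f p + g p | f g. f \<in> Cinf \<and> g \<in> Cinf}"], goal_cases)
  case (4 h b)
  then obtain f g where h: "h = (\<lambda>p. f p + g p)" "f \<in> Cinf" "g \<in> Cinf" by auto
  have "partial_deriv b h = (\<lambda>p. partial_deriv b f p + partial_deriv b g p)"
    unfolding h using partial_deriv_eq[OF has_derivative_add[OF h(2,3)[THEN Cinf_has_derivative]]]
    by (simp add: partial_deriv_def)
  then show ?case using h 4 Cinf_partial_deriv by blast
next
  case (3 h p)
  then show ?case by (auto intro: differentiable_add[OF Cinf_differentiable Cinf_differentiable])
qed (use assms in \<open>auto simp: Cinf_periodic\<close>)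

lemma Cinf_cmult:
  assumes "f \<in> Cinf"
  shows "(\<lambda>p. c * f p) \<in> Cinf"
proof (rule CinfI[where X="{\<lambda>p. c * f p | f. f \<in> Cinf}"], goal_cases)
  case (4 h b)
  then obtain f where h: "h = (\<lambda>p. c * f p)" "f \<in> Cinf" by auto
  have "partial_deriv b h = (\<lambda>p. c * partial_deriv b f p)"
    unfolding h using partial_deriv_eq[OF has_derivative_mult_right[OF h(2)[THEN Cinf_has_derivative]]]
    by (simp add: partial_deriv_def)
  then show ?case using h 4 Cinf_partial_deriv by blast
next
  case (3 h p)
  then show ?case by (auto intro: differentiable_mult[OF differentiable_const Cinf_differentiable])
qed (use assms in \<open>auto simp: Cinf_periodic\<close>)

lemma Cinf_exp:
  assumes "\<And>b. b \<in> Basis \<Longrightarrow> a \<bullet> b \<in> \<int>"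
  shows "(\<lambda>p::'a::euclidean_space. exp (\<i> * of_real (p \<bullet> a))) \<in> Cinf"
proof -
  have D: "((\<lambda>p. c * exp (\<i> * of_real (p \<bullet> a))) has_derivative
      (\<lambda>h. (c * \<i> * of_real (h \<bullet> a)) * exp (\<i> * of_real (p \<bullet> a)))) (at p)" for c and p :: 'a
  proof -
    have "((\<lambda>p. \<i> * of_real (p \<bullet> a)) has_derivative (\<lambda>h. \<i> * of_real (h \<bullet> a))) (at p)"
      by (auto intro!: derivative_eq_intros)
    from has_derivative_compose[OF this DERIV_exp[unfolded has_field_derivative_def]]
    have "((\<lambda>p. exp (\<i> * of_real (p \<bullet> a))) has_derivative
        (\<lambda>h. exp (\<i> * of_real (p \<bullet> a)) * (\<i> * of_real (h \<bullet> a)))) (at p)" .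
    from has_derivative_mult_right[OF this, of c] show ?thesis
      by (simp add: mult_ac)
  qed
  have "(\<lambda>p::'a. 1 * exp (\<i> * of_real (p \<bullet> a))) \<in> Cinf"
  proof (rule CinfI[where X="{\<lambda>p. c * exp (\<i> * of_real (p \<bullet> a)) | c. True}"], goal_cases)
    case (2 g b p)
    obtain k where k: "b \<bullet> a = of_int k"
      using assms[OF 2(2)] by (auto simp: inner_commute Ints_def)
    have "exp (\<i> * of_real ((p + (2 * pi) *\<^sub>R b) \<bullet> a)) =
        exp (\<i> * of_real (p \<bullet> a)) * exp (2 * of_int k * of_real pi * \<i>)"
      by (simp add: inner_add_left k flip: exp_add) (simp add: algebra_simps)
    then have "exp (\<i> * of_real ((p + (2 * pi) *\<^sub>R b) \<bullet> a)) = exp (\<i> * of_real (p \<bullet> a))"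
      using exp_integer_2pi[of "of_int k"] by (simp add: mult_ac)
    then show ?case using 2 by auto
  next
    case (3 g p)
    then show ?case using D by (auto simp: differentiable_def)
  next
    case (4 g b)
    then obtain c where "g = (\<lambda>p. c * exp (\<i> * of_real (p \<bullet> a)))" by auto
    then show ?case using partial_deriv_eq[OF D, of b c] by auto
  qed blast
  then show ?thesis by simp
qed

lemma Cinf_bounded:
  assumes f: "f \<in> Cinf"
  shows "bdd_above (range (\<lambda>p. norm (f p)))"
proof -
  have nat_shift: "f (p + (2 * pi * of_nat n) *\<^sub>R b) = f p" if "b \<in> Basis" for p b and n :: nat
  proof (induction n)
    case (Suc n)
    have "f (p + (2 * pi * of_nat (Suc n)) *\<^sub>R b) =
        f ((p + (2 * pi * of_nat n) *\<^sub>R b) + (2 * pi) *\<^sub>R b)"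
      by (simp add: algebra_simps)
    also have "\<dots> = f p"
      by (simp only: Cinf_periodic[OF f that] Suc.IH)
    finally show ?case .
  qed simp
  have int_shift: "f (p + (2 * pi * of_int n) *\<^sub>R b) = f p" if "b \<in> Basis" for p b and n :: int
  proof (cases n)
    case (nonneg k)
    then show ?thesis using nat_shift[OF that, of p k] by simp
  next
    case (neg k)
    then have "p = (p + (2 * pi * of_int n) *\<^sub>R b) + (2 * pi * of_nat (Suc k)) *\<^sub>R b"
      by (simp add: add.assoc flip: scaleR_left.add distrib_left)
    then show ?thesis
      using nat_shift[OF that] by metis
  qed
  have sum_shift: "f (p + (\<Sum>b\<in>B. (2 * pi * of_int (n b)) *\<^sub>R b)) = f p" if "B \<subseteq> Basis" for p n B
    using finite_subset[OF that finite_Basis] that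
  proof (induction arbitrary: p)
    case (insert b B)
    have "f (p + (\<Sum>b\<in>insert b B. (2 * pi * of_int (n b)) *\<^sub>R b)) =
       f (p + (2 * pi * of_int (n b)) *\<^sub>R b + (\<Sum>b\<in>B. (2 * pi * of_int (n b)) *\<^sub>R b))"
      using insert by (simp add: add.assoc)
    then show ?case using insert int_shift by simp
  qed simp
  have "compact (f ` cbox 0 ((2 * pi) *\<^sub>R One))"
    by (intro compact_continuous_image Cinf_continuous f compact_cbox)
  then obtain M where M: "norm (f q) \<le> M" if "q \<in> cbox 0 ((2 * pi) *\<^sub>R One)" for q
    by (force dest!: compact_imp_bounded simp: bounded_iff)
  have "norm (f p) \<le> M" for p
  proof -
    \<comment> \<open>Translate \<open>p\<close> by lattice vectors into the fundamental cube.\<close>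
    define n where "n = (\<lambda>b. \<lfloor>(p \<bullet> b) / (2 * pi)\<rfloor>)"
    define q where "q = p + (\<Sum>b\<in>Basis. (2 * pi * of_int (- n b)) *\<^sub>R b)"
    have "q \<bullet> b = p \<bullet> b - 2 * pi * of_int (n b)" if "b \<in> Basis" for b
      using that by (simp add: q_def inner_add_left inner_sum_left inner_Basis if_distrib cong: if_cong)
    moreover have "2 * pi * of_int \<lfloor>x / (2 * pi)\<rfloor> \<le> x \<and> x \<le> 2 * pi * of_int \<lfloor>x / (2 * pi)\<rfloor> + 2 * pi" for x
    proof
      have "of_int \<lfloor>x / (2 * pi)\<rfloor> * (2 * pi) \<le> x"
        by (subst pos_le_divide_eq[symmetric]) simp_all
      then show "2 * pi * of_int \<lfloor>x / (2 * pi)\<rfloor> \<le> x" by (simp add: mult_ac)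
      have "x \<le> (of_int \<lfloor>x / (2 * pi)\<rfloor> + 1) * (2 * pi)"
        by (subst pos_divide_le_eq[symmetric]) (simp, linarith)
      then show "x \<le> 2 * pi * of_int \<lfloor>x / (2 * pi)\<rfloor> + 2 * pi" by (simp add: algebra_simps)
    qed
    ultimately have "0 \<le> q \<bullet> b \<and> q \<bullet> b \<le> 2 * pi" if "b \<in> Basis" for b
      using that unfolding n_def by (smt (verit))
    then have "q \<in> cbox 0 ((2 * pi) *\<^sub>R One)"
      by (auto simp: mem_box)
    moreover have "f q = f p"
      unfolding q_def by (rule sum_shift) simp
    ultimately show ?thesis using M by metis
  qed
  then show ?thesis by (auto intro!: bdd_aboveI2)
qed

lemma norm_le_SUP: "f \<in> Cinf \<Longrightarrow> norm (f p) \<le> (SUP p. norm (f p))"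
  by (rule cSUP_upper) (auto intro: Cinf_bounded)

lemma SUP_norm_nonneg: "f \<in> Cinf \<Longrightarrow> 0 \<le> (SUP p. norm (f p))"
  using norm_le_SUP[of f undefined] norm_ge_zero[of "f undefined"] by linarith

lemma Cinf_norm_nonneg: "f \<in> Cinf \<Longrightarrow> 0 \<le> Cinf_norm N f"
  unfolding Cinf_norm_def by (intro sum_nonneg SUP_norm_nonneg Cinf_iter_partial) auto

lemma Cinf_norm_0: "Cinf_norm 0 f = (SUP p. norm (f p))"
proof -
  have "{bs \<in> lists Basis. length bs \<le> 0} = {[] :: 'a list}" by auto
  then show ?thesis by (simp add: Cinf_norm_def)
qed

lemma Cinf_norm_le:
  assumes f: "f \<in> Cinf"
    and "\<And>bs p. bs \<in> lists Basis \<Longrightarrow> norm (iter_partial bs g p) \<le> M * (SUP p. norm (iter_partial bs f p))"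
  shows "Cinf_norm N g \<le> M * Cinf_norm N f"
  unfolding Cinf_norm_def sum_distrib_left
  by (intro sum_mono cSUP_least) (use assms in auto)

section \<open>Integrals over a period and Fourier coefficients\<close>

lemma
  fixes g :: "nat \<Rightarrow> 'a::euclidean_space \<Rightarrow> 'b::banach"
  assumes g: "\<And>j. continuous_on UNIV (g j)" "\<And>j p. norm (g j p) \<le> M j" and M: "summable M"
  shows continuous_suminf: "continuous_on A (\<lambda>p. \<Sum>j. g j p)"
    and sums_integral_suminf:
      "(\<lambda>j. integral (cbox a b) (g j)) sums integral (cbox a b) (\<lambda>p. \<Sum>j. g j p)"
proof -
  have cont: "continuous_on X (\<lambda>p. \<Sum>i<n. g i p)" for X n
    by (intro continuous_intros continuous_on_subset[OF g(1)]) auto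
  have lim: "uniform_limit X (\<lambda>n p. \<Sum>i<n. g i p) (\<lambda>p. \<Sum>j. g j p) sequentially" for X
    by (rule Weierstrass_m_test[OF g(2) M])
  show "continuous_on A (\<lambda>p. \<Sum>j. g j p)"
    by (rule uniform_limit_theorem[OF always_eventually lim]) (auto intro: cont)
  obtain I J where I: "\<And>n. ((\<lambda>p. \<Sum>i<n. g i p) has_integral I n) (cbox a b)"
    and J: "((\<lambda>p. \<Sum>j. g j p) has_integral J) (cbox a b)" and "I \<longlonglongrightarrow> J"
    using uniform_limit_integral_cbox[OF lim cont trivial_limit_sequentially] by blast
  have "I n = (\<Sum>i<n. integral (cbox a b) (g i))" for n
    using integral_unique[OF I[of n]]
    by (simp add: integral_sum integrable_continuous continuous_on_subset[OF g(1)])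
  then have "I = (\<lambda>n. \<Sum>i<n. integral (cbox a b) (g i))" by blast
  with \<open>I \<longlonglongrightarrow> J\<close> integral_unique[OF J]
  show "(\<lambda>j. integral (cbox a b) (g j)) sums integral (cbox a b) (\<lambda>p. \<Sum>j. g j p)"
    by (simp add: sums_def)
qed

text \<open>
  Fourier coefficients are left unnormalised, and the sign of the exponent is such that
  \<^term>\<open>fcoef n\<close> agrees on smooth periodic functions with the distribution given by the function \<open>exp (\<i> n x)\<close>.
\<close>
definition fcoef :: "int \<Rightarrow> (real \<Rightarrow> complex) \<Rightarrow> complex" where
  "fcoef n f = integral {0..2 * pi} (\<lambda>x. exp (\<i> * of_int n * of_real x) * f x)"

lemma fcoef_cmult: "fcoef n (\<lambda>x. c * f x) = c * fcoef n f"
proof -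
  have "(\<lambda>x. exp (\<i> * of_int n * complex_of_real x) * (c * f x)) =
      (\<lambda>x. c * (exp (\<i> * of_int n * of_real x) * f x))" by (simp add: mult_ac)
  then show ?thesis by (simp add: fcoef_def)
qed

lemma fcoef_add:
  assumes "continuous_on UNIV f" "continuous_on UNIV g"
  shows "fcoef n (\<lambda>x. f x + g x) = fcoef n f + fcoef n g"
  unfolding fcoef_def distrib_left
  by (intro integral_add integrable_continuous_real continuous_intros
      continuous_on_subset[OF assms(1)] continuous_on_subset[OF assms(2)]) auto

lemma exp_periodic: "exp (\<i> * of_int n * of_real (x + 2 * pi)) = exp (\<i> * of_int n * of_real x)"
  using exp_plus_2pin[of "\<i> * of_int n * of_real x" n] by (simp add: algebra_simps)

lemma fcoef_deriv:
  assumes f: "\<And>x. (f has_vector_derivative f' x) (at x)"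
    and cont: "continuous_on UNIV f'" and per: "f (2 * pi) = f 0"
  shows "fcoef n (\<lambda>x. \<i> * f' x) = of_int n * fcoef n f"
proof -
  let ?e = "\<lambda>x. exp (\<i> * of_int n * complex_of_real x)"
  have "(?e has_vector_derivative \<i> * of_int n * ?e x) (at x)" for x
  proof -
    have "((\<lambda>z. exp (\<i> * of_int n * z)) has_field_derivative \<i> * of_int n * ?e x) (at (of_real x))"
      by (auto intro!: derivative_eq_intros)
    from has_vector_derivative_real_field[OF this] show ?thesis .
  qed
  from has_vector_derivative_mult[OF this f]
  have D: "((\<lambda>x. ?e x * f x) has_vector_derivative ?e x * f' x + \<i> * of_int n * ?e x * f x)
      (at x within {0..2 * pi})" for x
    by (rule has_vector_derivative_at_within)
  have "((\<lambda>x. ?e x * f' x + \<i> * of_int n * ?e x * f x) has_integral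
      ?e (2 * pi) * f (2 * pi) - ?e 0 * f 0) {0..2 * pi}"
    by (intro fundamental_theorem_of_calculus D) auto
  moreover have "?e (2 * pi) = 1"
    using exp_periodic[of n 0] by simp
  ultimately have zero: "integral {0..2 * pi} (\<lambda>x. ?e x * f' x + \<i> * of_int n * ?e x * f x) = 0"
    using per by (simp add: integral_unique)
  have cont_f: "continuous_on UNIV f"
    using f by (meson continuous_at_imp_continuous_on has_vector_derivative_continuous)
  have "(\<lambda>x. ?e x * f' x + \<i> * of_int n * ?e x * f x) =
      (\<lambda>x. ?e x * (f' x + \<i> * of_int n * f x))"
    by (simp add: algebra_simps)
  with zero have "fcoef n (\<lambda>x. f' x + \<i> * of_int n * f x) = 0"
    by (simp add: fcoef_def)
  then have "fcoef n f' + \<i> * of_int n * fcoef n f = 0"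
    by (subst (asm) fcoef_add) (auto intro!: cont continuous_intros cont_f simp: fcoef_cmult)
  then have "\<i> * (fcoef n f' + \<i> * of_int n * fcoef n f) = 0"
    by simp
  then show ?thesis
    by (simp add: fcoef_cmult algebra_simps)
qed

lemma fcoef_1: "fcoef n (\<lambda>_. 1) = (if n = 0 then 2 * pi else 0)"
  using fcoef_deriv[of "\<lambda>_. 1" "\<lambda>_. 0" n] by (auto simp: fcoef_def scaleR_conv_of_real)

lemma fcoef_exp: "fcoef n (\<lambda>x. exp (\<i> * of_int m * of_real x)) = (if n = - m then 2 * pi else 0)"
proof -
  have "fcoef n (\<lambda>x. exp (\<i> * of_int m * of_real x)) = fcoef (n + m) (\<lambda>_. 1)"
    unfolding fcoef_def mult_exp_exp by (simp add: algebra_simps)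
  then show ?thesis by (auto simp: fcoef_1)
qed

lemma integral_period_shift:
  fixes f :: "real \<Rightarrow> complex"
  assumes cont: "continuous_on UNIV f" and per: "\<And>x. f (x + 2 * pi) = f x"
    and y: "0 \<le> y" "y \<le> 2 * pi"
  shows "integral {0..2 * pi} (\<lambda>x. f (x - y)) = integral {0..2 * pi} f"
proof -
  have int: "f integrable_on {a..b}" for a b
    by (rule integrable_continuous_real) (auto intro: continuous_on_subset[OF cont])
  have shift: "integral {a..b} (\<lambda>x. f (x + c)) = integral {a + c..b + c} f" for a b c
    using integral_shift_Icc_real[of a b f c] by (simp add: add.commute comp_def)
  have "integral {0..2 * pi} (\<lambda>x. f (x - y)) = integral {- y..2 * pi - y} f"
    using shift[of 0 "2 * pi" "- y"] by simp
  also have "\<dots> = integral {- y..0} f + integral {0..2 * pi - y} f"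
    by (rule Henstock_Kurzweil_Integration.integral_combine[symmetric]) (use y int in auto)
  also have "integral {- y..0} f = integral {2 * pi - y..2 * pi} f"
    using shift[of "- y" 0 "2 * pi"] per by simp
  also have "integral {2 * pi - y..2 * pi} f + integral {0..2 * pi - y} f = integral {0..2 * pi} f"
    using y Henstock_Kurzweil_Integration.integral_combine[of 0 "2 * pi - y" "2 * pi" f] int by (simp add: add.commute)
  finally show ?thesis .
qed

lemma fcoef_reflect:
  assumes cont: "continuous_on UNIV f" and per: "\<And>x. f (x + 2 * pi) = f x"
  shows "fcoef n (\<lambda>x. f (- x)) = fcoef (- n) f"
proof -
  let ?g = "\<lambda>x. exp (\<i> * of_int (- n) * of_real x) * f x"
  have "fcoef n (\<lambda>x. f (- x)) = integral {0..2 * pi} (\<lambda>x. ?g (- x))"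
    by (simp add: fcoef_def)
  also have "\<dots> = integral {- (2 * pi)..0} ?g"
    using Henstock_Kurzweil_Integration.integral_reflect_real[of 0 "- (2 * pi)" ?g] by (simp only: minus_zero minus_minus)
  also have "\<dots> = integral {0..2 * pi} (\<lambda>x. ?g (x - 2 * pi))"
    using integral_shift_Icc_real[of 0 "2 * pi" ?g "- 2 * pi"] by (simp add: comp_def)
  also have "\<dots> = fcoef (- n) f"
    unfolding fcoef_def
  proof (rule integral_period_shift)
    show "continuous_on UNIV ?g"
      by (intro continuous_intros cont)
    show "?g (x + 2 * pi) = ?g x" for x
      by (simp only: exp_periodic per)
  qed auto
  finally show ?thesis .
qed

section \<open>Convolution in one direction of the torus\<close>

text \<open>
  Convolution of \<open>f\<close> with a kernel \<open>K\<close> on the circle, in the direction \<open>b\<close>. The direction is a parameter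
  so that the same lemmas cover functions of \<open>x\<close> (with \<open>b = 1\<close>) and functions of \<open>(t, x)\<close>
  (with \<open>b = (0, 1)\<close>).
\<close>
definition conv :: "(real \<Rightarrow> complex) \<Rightarrow> 'a::euclidean_space \<Rightarrow> ('a \<Rightarrow> complex) \<Rightarrow> 'a \<Rightarrow> complex" where
  "conv K b f = (\<lambda>p. integral {0..2 * pi} (\<lambda>y. K y * f (p - y *\<^sub>R b)))"

lemma conv_integrable:
  fixes K :: "real \<Rightarrow> complex" and f :: "'a::euclidean_space \<Rightarrow> complex"
  assumes "continuous_on UNIV K" "continuous_on UNIV f"
  shows "(\<lambda>y. K y * f (p - y *\<^sub>R b)) integrable_on {0..2 * pi}"
  by (intro integrable_continuous_real continuous_intros continuous_on_subset[OF assms(1)]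
      continuous_on_compose2[OF assms(2)]) auto

text \<open>Differentiation under the integral sign. Only \<open>f\<close> is differentiated, so that a continuous
  kernel suffices.\<close>
lemma conv_has_derivative:
  assumes K: "continuous_on UNIV K" and f: "f \<in> Cinf"
  obtains f' where "\<And>p. (conv K b f has_derivative f' p) (at p)"
    and "\<And>p c. c \<in> Basis \<Longrightarrow> f' p c = conv K b (partial_deriv c f) p"
proof -
  define D where "D = (\<lambda>p y. Blinfun (\<lambda>h. K y * frechet_derivative f (at (p - y *\<^sub>R b)) h))"
  have D: "blinfun_apply (D p y) = (\<lambda>h. K y * frechet_derivative f (at (p - y *\<^sub>R b)) h)" for p y
    unfolding D_def
    by (intro bounded_linear_Blinfun_apply bounded_linear_const_mult
        has_derivative_bounded_linear[OF Cinf_has_derivative[OF f]])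
  have cont: "continuous_on A (\<lambda>(p, y). D p y)" for A
  proof (rule continuous_on_blinfun_componentwise)
    fix c :: 'a assume c: "c \<in> Basis"
    have "continuous_on A (\<lambda>(p, y). K y * partial_deriv c f (p - y *\<^sub>R b))"
      unfolding split_def
      by (intro continuous_intros continuous_on_compose2[OF K]
          continuous_on_compose2[OF Cinf_continuous[OF Cinf_partial_deriv[OF f c], of UNIV]]) auto
    then show "continuous_on A (\<lambda>x. blinfun_apply (case x of (p, y) \<Rightarrow> D p y) c)"
      by (simp add: split_def D partial_deriv_def)
  qed
  have "(conv K b f has_derivative integral (cbox 0 (2 * pi)) (D p)) (at p within UNIV)" for p
    unfolding conv_def cbox_interval[symmetric]
  proof (rule leibniz_rule)
    show "((\<lambda>p. K y * f (p - y *\<^sub>R b)) has_derivative blinfun_apply (D p y)) (at p within UNIV)" for p y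
    proof -
      have "((\<lambda>p. p - y *\<^sub>R b) has_derivative (\<lambda>h. h)) (at p)"
        by (auto intro!: derivative_eq_intros)
      then have "((\<lambda>p. f (p - y *\<^sub>R b)) has_derivative frechet_derivative f (at (p - y *\<^sub>R b))) (at p)"
        by (rule has_derivative_compose) (rule Cinf_has_derivative[OF f])
      from has_derivative_mult_right[OF this] show ?thesis by (simp add: D)
    qed
    show "(\<lambda>y. K y * f (p - y *\<^sub>R b)) integrable_on cbox 0 (2 * pi)" for p
      using conv_integrable[OF K Cinf_continuous[OF f]] by simp
  qed (auto intro: cont)
  moreover have "blinfun_apply (integral (cbox 0 (2 * pi)) (D p)) c = conv K b (partial_deriv c f) p"
    for p c
  proof -
    have "continuous_on (cbox 0 (2 * pi)) (D p)"
      using continuous_on_compose2[OF cont[of UNIV], of "cbox 0 (2 * pi)" "\<lambda>y. (p, y)"]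
      by (simp add: continuous_on_Pair continuous_on_const continuous_on_id)
    then have "D p integrable_on cbox 0 (2 * pi)"
      by (rule integrable_continuous)
    then show ?thesis
      by (simp add: blinfun_apply_integral D conv_def partial_deriv_def)
  qed
  ultimately show ?thesis
    by (intro that[of "\<lambda>p. blinfun_apply (integral (cbox 0 (2 * pi)) (D p))"]) auto
qed

lemma partial_deriv_conv:
  assumes "continuous_on UNIV K" "f \<in> Cinf" "c \<in> Basis"
  shows "partial_deriv c (conv K b f) = conv K b (partial_deriv c f)"
  using conv_has_derivative[OF assms(1,2), of b] assms(3) by (metis (no_types) ext partial_deriv_eq)

lemma iter_partial_conv:
  assumes "continuous_on UNIV K" "f \<in> Cinf" "bs \<in> lists Basis"
  shows "iter_partial bs (conv K b f) = conv K b (iter_partial bs f)"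
  using assms(3)
  by induction (simp_all add: partial_deriv_conv[OF assms(1)] Cinf_iter_partial[OF assms(2)])

lemma Cinf_conv:
  assumes K: "continuous_on UNIV K" and f: "f \<in> Cinf"
  shows "conv K b f \<in> Cinf"
proof (rule CinfI[where X="{conv K b f | f. f \<in> Cinf}"], goal_cases)
  case (2 g c p)
  then obtain f where f: "g = conv K b f" "f \<in> Cinf" by auto
  have "f (p + (2 * pi) *\<^sub>R c - y *\<^sub>R b) = f (p - y *\<^sub>R b)" for y
    using Cinf_periodic[OF f(2) 2(2), of "p - y *\<^sub>R b"] by (simp add: algebra_simps)
  then show ?case by (simp add: f conv_def)
next
  case (3 g p)
  then obtain f where f: "g = conv K b f" "f \<in> Cinf" by auto
  show ?case
    unfolding f differentiable_def by (rule conv_has_derivative[OF K f(2), of b]) blast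
next
  case (4 g c)
  then obtain f where f: "g = conv K b f" "f \<in> Cinf" by auto
  show ?case
    unfolding f partial_deriv_conv[OF K f(2) 4(2)] using Cinf_partial_deriv[OF f(2) 4(2)] by blast
qed (use f in blast)

lemma conv_bound:
  assumes K: "continuous_on UNIV K" and KM: "\<And>y. norm (K y) \<le> M" and f: "f \<in> Cinf"
  shows "norm (conv K b f p) \<le> M * (SUP p. norm (f p)) * (2 * pi)"
proof -
  have "norm (integral {0..2 * pi} (\<lambda>y. K y * f (p - y *\<^sub>R b))) \<le> M * (SUP p. norm (f p)) * (2 * pi - 0)"
  proof (rule integral_bound)
    show "continuous_on {0..2 * pi} (\<lambda>y. K y * f (p - y *\<^sub>R b))"
      by (intro continuous_intros continuous_on_subset[OF K]
          continuous_on_compose2[OF Cinf_continuous[OF f, of UNIV]]) auto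
    show "norm (K y * f (p - y *\<^sub>R b)) \<le> M * (SUP p. norm (f p))" for y
      unfolding norm_mult
      by (intro mult_mono KM norm_le_SUP f norm_ge_zero order_trans[OF norm_ge_zero KM])
  qed auto
  then show ?thesis by (simp add: conv_def)
qed

lemma Cinf_norm_conv:
  assumes K: "continuous_on UNIV K" and KM: "\<And>y. norm (K y) \<le> M" and f: "f \<in> Cinf"
  shows "Cinf_norm N (conv K b f) \<le> (2 * pi * M) * Cinf_norm N f"
proof (rule Cinf_norm_le[OF f])
  fix bs p assume bs: "bs \<in> lists (Basis :: 'a set)"
  show "norm (iter_partial bs (conv K b f) p) \<le> (2 * pi * M) * (SUP p. norm (iter_partial bs f p))"
    using conv_bound[OF K KM Cinf_iter_partial[OF f bs], of b p]
    by (simp add: iter_partial_conv[OF K f bs] mult_ac)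
qed

text \<open>For a unit vector \<open>b\<close>, the reflection that maps \<open>b\<close> to \<open>-b\<close> and fixes its orthogonal complement.\<close>
definition mirror :: "'a::euclidean_space \<Rightarrow> 'a \<Rightarrow> 'a" where
  "mirror b p = p - (2 * (p \<bullet> b)) *\<^sub>R b"

lemma linear_mirror: "linear (mirror b)"
  by (rule linearI) (auto simp: mirror_def inner_add_left algebra_simps)

lemma refl_Basis: "b \<in> Basis \<Longrightarrow> c \<in> Basis \<Longrightarrow> mirror b c = (if c = b then - 1 else 1) *\<^sub>R c"
  by (auto simp: mirror_def inner_Basis scaleR_2)

lemma has_derivative_mirror:
  assumes f: "f \<in> Cinf"
  shows "((\<lambda>p. f (mirror b p)) has_derivative
    (\<lambda>h. frechet_derivative f (at (mirror b p)) (mirror b h))) (at p)"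
  by (rule has_derivative_compose[OF linear_imp_has_derivative[OF linear_mirror] Cinf_has_derivative[OF f]])

lemma partial_deriv_mirror:
  assumes f: "f \<in> Cinf" and b: "b \<in> Basis" and c: "c \<in> Basis"
  shows "partial_deriv c (\<lambda>p. f (mirror b p)) =
    (\<lambda>p. (if c = b then - 1 else 1) * partial_deriv c f (mirror b p))"
proof -
  have "linear (frechet_derivative f (at (mirror b p)))" for p
    using has_derivative_linear[OF Cinf_has_derivative[OF f]] .
  then show ?thesis
    using partial_deriv_eq[OF has_derivative_mirror[OF f]] refl_Basis[OF b c]
    by (auto simp: partial_deriv_def linear_neg)
qed

lemma Cinf_mirror:
  assumes f: "f \<in> Cinf" and b: "b \<in> Basis"
  shows "(\<lambda>p. f (mirror b p)) \<in> Cinf"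
proof (rule CinfI[where X="{\<lambda>p. f (mirror b p) | f. f \<in> Cinf}"], goal_cases)
  case (2 g c p)
  then obtain f where f: "g = (\<lambda>p. f (mirror b p))" "f \<in> Cinf" by auto
  have "mirror b (p + (2 * pi) *\<^sub>R c) = mirror b p + (2 * pi) *\<^sub>R mirror b c"
    by (simp add: linear_add[OF linear_mirror] linear_scale[OF linear_mirror])
  then show ?case
    using refl_Basis[OF b 2(2)] Cinf_periodic[OF f(2) 2(2), of "mirror b p"]
      Cinf_periodic[OF f(2) 2(2), of "mirror b p - (2 * pi) *\<^sub>R c"]
    by (auto simp: f split: if_splits)
next
  case (3 g p)
  then show ?case using has_derivative_mirror by (auto simp: differentiable_def)
next
  case (4 g c)
  then obtain f where f: "g = (\<lambda>p. f (mirror b p))" "f \<in> Cinf" by auto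
  have "(\<lambda>p. (if c = b then - 1 else 1) * partial_deriv c f p) \<in> Cinf"
    using Cinf_cmult[OF Cinf_partial_deriv[OF f(2) 4(2)]] .
  then show ?case
    unfolding f partial_deriv_mirror[OF f(2) b 4(2)]
    by (intro CollectI exI conjI) (rule refl)
qed (use f in blast)

text \<open>Differentiation commutes with the reflection up to a sign \<open>\<sigma>\<close>: a factor \<open>-1\<close> for each derivative
  in the direction \<open>b\<close>.\<close>
lemma iter_partial_mirror:
  assumes f: "f \<in> Cinf" and b: "b \<in> Basis" and "bs \<in> lists Basis"
  shows "\<exists>\<sigma>. norm \<sigma> = 1 \<and>
    iter_partial bs (\<lambda>p. f (mirror b p)) = (\<lambda>p. \<sigma> * iter_partial bs f (mirror b p))"
  using assms(3)
proof induction
  case Nil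
  then show ?case by (auto intro: exI[of _ 1])
next
  case (Cons c bs)
  then obtain \<sigma> where \<sigma>: "norm \<sigma> = 1"
    "iter_partial bs (\<lambda>p. f (mirror b p)) = (\<lambda>p. \<sigma> * iter_partial bs f (mirror b p))" by auto
  let ?g = "iter_partial bs f"
  have g: "?g \<in> Cinf" "(\<lambda>p. ?g (mirror b p)) \<in> Cinf"
    using Cons Cinf_iter_partial[OF f] Cinf_mirror[OF _ b] by auto
  have "partial_deriv c (\<lambda>p. \<sigma> * ?g (mirror b p)) = (\<lambda>p. \<sigma> * partial_deriv c (\<lambda>p. ?g (mirror b p)) p)"
    using partial_deriv_eq[OF has_derivative_mult_right[OF g(2)[THEN Cinf_has_derivative]]]
    by (simp add: partial_deriv_def)
  then show ?case
    using partial_deriv_mirror[OF g(1) b Cons.hyps(1)] \<sigma>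
    by (intro exI[of _ "\<sigma> * (if c = b then - 1 else 1)"]) (auto simp: norm_mult)
qed

lemma Cinf_norm_mirror:
  assumes f: "f \<in> Cinf" and b: "b \<in> Basis"
  shows "Cinf_norm N (\<lambda>p. f (mirror b p)) \<le> Cinf_norm N f"
proof -
  have "Cinf_norm N (\<lambda>p. f (mirror b p)) \<le> 1 * Cinf_norm N f"
  proof (rule Cinf_norm_le[OF f])
    fix bs p assume bs: "bs \<in> lists (Basis :: 'a set)"
    obtain \<sigma> where \<sigma>: "norm \<sigma> = 1"
      "iter_partial bs (\<lambda>p. f (mirror b p)) = (\<lambda>p. \<sigma> * iter_partial bs f (mirror b p))"
      using iter_partial_mirror[OF f b bs] by blast
    show "norm (iter_partial bs (\<lambda>p. f (mirror b p)) p) \<le> 1 * (SUP p. norm (iter_partial bs f p))"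
      using norm_le_SUP[OF Cinf_iter_partial[OF f bs]] by (simp add: \<sigma> norm_mult)
  qed
  then show ?thesis by simp
qed

section \<open>Perturbations with absolutely summable symbols\<close>

lemma fcoef_conv:
  assumes K: "continuous_on UNIV K" and f: "f \<in> Cinf"
  shows "fcoef n (conv K 1 f) = fcoef n K * fcoef n f"
proof -
  let ?e = "\<lambda>x. exp (\<i> * of_int n * complex_of_real x)"
  note cf = Cinf_continuous[OF f, of UNIV]
  have per: "f (x + 2 * pi) = f x" for x
    using Cinf_periodic[OF f, of 1 x] by simp
  have "fcoef n (conv K 1 f) =
      integral {0..2 * pi} (\<lambda>x. integral {0..2 * pi} (\<lambda>y. ?e x * (K y * f (x - y))))"
    by (simp add: fcoef_def conv_def)
  also have "\<dots> = integral {0..2 * pi} (\<lambda>y. integral {0..2 * pi} (\<lambda>x. ?e x * (K y * f (x - y))))"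
    unfolding cbox_interval[symmetric]
  proof (rule integral_swap_continuous)
    show "continuous_on (cbox (0, 0) (2 * pi, 2 * pi)) (\<lambda>(x, y). ?e x * (K y * f (x - y)))"
      unfolding split_def
      by (intro continuous_intros continuous_on_compose2[OF K] continuous_on_compose2[OF cf]) auto
  qed
  also have "\<dots> = integral {0..2 * pi} (\<lambda>y. (?e y * K y) * fcoef n f)"
  proof (rule integral_cong)
    fix y assume y: "y \<in> {0..2 * pi}"
    have e: "?e x = ?e y * ?e (x - y)" for x
      by (simp add: algebra_simps flip: exp_add)
    have "?e x * (K y * f (x - y)) = (?e y * K y) * (?e (x - y) * f (x - y))" for x
      unfolding e[of x] by (simp only: mult_ac)
    then have "(\<lambda>x. ?e x * (K y * f (x - y))) = (\<lambda>x. (?e y * K y) * (?e (x - y) * f (x - y)))"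
      by (rule ext)
    moreover have "integral {0..2 * pi} (\<lambda>x. ?e (x - y) * f (x - y)) = fcoef n f"
      unfolding fcoef_def
    proof (rule integral_period_shift)
      show "continuous_on UNIV (\<lambda>x. ?e x * f x)"
        by (intro continuous_intros cf)
      show "?e (x + 2 * pi) * f (x + 2 * pi) = ?e x * f x" for x
        by (simp only: exp_periodic per)
    qed (use y in auto)
    ultimately show "integral {0..2 * pi} (\<lambda>x. ?e x * (K y * f (x - y))) = (?e y * K y) * fcoef n f"
      by simp
  qed
  also have "\<dots> = fcoef n K * fcoef n f"
    by (simp add: fcoef_def)
  finally show ?thesis .
qed

text \<open>The even kernel on the circle whose unnormalised Fourier coefficient at \<open>n\<close> is \<open>r \<bar>n\<bar>\<close> when
  \<open>r 0 = 0\<close>: each cosine splits into two characters, each of them contributing \<open>r j / (2 * pi)\<close>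
  times the length \<open>2 * pi\<close> of the circle.\<close>
definition kern :: "(nat \<Rightarrow> real) \<Rightarrow> real \<Rightarrow> complex" where
  "kern r y = (\<Sum>j. of_real (r j / pi * cos (of_nat j * y)))"

lemma kern_term_bound: "norm (complex_of_real (r j / pi * cos (of_nat j * y))) \<le> \<bar>r j\<bar>"
proof -
  have "\<bar>r j\<bar> * \<bar>cos (of_nat j * y)\<bar> \<le> \<bar>r j\<bar> * pi"
    by (intro mult_left_mono order_trans[OF abs_cos_le_one]) (use pi_ge_two in auto)
  then show ?thesis by (simp add: norm_mult norm_divide abs_mult pos_divide_le_eq)
qed

lemma kern_term_continuous:
  "continuous_on A (\<lambda>y. complex_of_real (r j / pi * cos (of_nat j * y)))"
  by (intro continuous_intros) auto

lemma continuous_kern: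
  assumes "summable (\<lambda>j. \<bar>r j\<bar>)"
  shows "continuous_on A (kern r)"
  unfolding kern_def
  by (rule continuous_suminf[where M="\<lambda>j. \<bar>r j\<bar>"])
     (intro kern_term_continuous kern_term_bound assms)+

lemma kern_bound:
  assumes "summable (\<lambda>j. \<bar>r j\<bar>)"
  shows "norm (kern r y) \<le> (\<Sum>j. \<bar>r j\<bar>)"
  unfolding kern_def
  by (rule norm_suminf_le) (intro kern_term_bound assms)+

lemma fcoef_kern:
  assumes r: "summable (\<lambda>j. \<bar>r j\<bar>)" and r0: "r 0 = 0"
  shows "fcoef n (kern r) = of_real (r (nat \<bar>n\<bar>))"
proof -
  let ?e = "\<lambda>y. exp (\<i> * of_int n * complex_of_real y)"
  let ?g = "\<lambda>j y. ?e y * complex_of_real (r j / pi * cos (of_nat j * y))"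
  have norm_e: "norm (?e y) = 1" for y
    using norm_exp_i_times[of "of_int n * y"] by (simp add: mult_ac)
  have "(\<lambda>j. integral (cbox 0 (2 * pi)) (?g j)) sums integral (cbox 0 (2 * pi)) (\<lambda>y. \<Sum>j. ?g j y)"
  proof (rule sums_integral_suminf[OF _ _ r])
    show "continuous_on UNIV (?g j)" for j
      by (intro continuous_intros kern_term_continuous)
    show "norm (?g j y) \<le> \<bar>r j\<bar>" for j y
      using kern_term_bound[of r j y] by (simp only: norm_mult norm_e mult_1)
  qed
  moreover have "(\<Sum>j. ?g j y) = ?e y * kern r y" for y
    unfolding kern_def
    by (rule suminf_mult[OF summable_comparison_test'[OF r kern_term_bound[where r=r and y=y]]])
  moreover have "integral (cbox 0 (2 * pi)) (?g j) = (if j = nat \<bar>n\<bar> then of_real (r j) else 0)" for j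
  proof -
    have "?g j = (\<lambda>y. of_real (r j / (2 * pi)) *
        (?e y * (exp (\<i> * of_int (int j) * of_real y) + exp (\<i> * of_int (- int j) * of_real y))))"
    proof (rule ext)
      fix y
      have cos: "exp (\<i> * of_int (int j) * of_real y) + exp (\<i> * of_int (- int j) * of_real y) =
          2 * complex_of_real (cos (of_nat j * y))"
        unfolding cos_of_real[symmetric] cos_exp_eq by (simp add: mult_ac)
      show "?g j y = of_real (r j / (2 * pi)) *
          (?e y * (exp (\<i> * of_int (int j) * of_real y) + exp (\<i> * of_int (- int j) * of_real y)))"
        unfolding cos by simp
    qed
    then have "integral (cbox 0 (2 * pi)) (?g j) =
        of_real (r j / (2 * pi)) * fcoef n
          (\<lambda>y. exp (\<i> * of_int (int j) * of_real y) + exp (\<i> * of_int (- int j) * of_real y))"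
      by (simp add: fcoef_def)
    also have "\<dots> = of_real (r j / (2 * pi)) *
        ((if n = - int j then 2 * pi else 0) + (if n = int j then 2 * pi else 0))"
      by (subst fcoef_add) (intro continuous_intros, intro continuous_intros, simp only: fcoef_exp minus_minus, simp)
    also have "\<dots> = (if j = nat \<bar>n\<bar> then of_real (r j) else 0)"
      using r0 by auto
    finally show ?thesis .
  qed
  ultimately have "(\<lambda>j. if j = nat \<bar>n\<bar> then complex_of_real (r j) else 0) sums fcoef n (kern r)"
    by (simp add: fcoef_def)
  moreover have "(\<lambda>j. if j = nat \<bar>n\<bar> then complex_of_real (r j) else 0) sums of_real (r (nat \<bar>n\<bar>))"
    by (rule sums_single)
  ultimately show ?thesis by (rule sums_unique2)
qed

text \<open>The transposed operator on functions: it multiplies the Fourier mode \<open>n\<close> in the direction \<open>b\<close>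
  by \<open>r \<bar>n\<bar>\<close> and adds \<open>g \<bar>n\<bar>\<close> times the mode \<open>-n\<close> when
  \<open>r 0 = g 0 = 0\<close> (see \<open>fcoef_multT\<close> below).\<close>
definition multT :: "(nat \<Rightarrow> real) \<Rightarrow> (nat \<Rightarrow> real) \<Rightarrow> 'a::euclidean_space \<Rightarrow> ('a \<Rightarrow> complex) \<Rightarrow> 'a \<Rightarrow> complex"
  where "multT r g b f = (\<lambda>p. conv (kern r) b f p + conv (kern g) b f (mirror b p))"

text \<open>The transpose of \<^term>\<open>multT r g 1\<close>, an operator on distributions in \<open>x\<close>. For summable \<open>r\<close> and
  \<open>g\<close> that vanish at \<open>0\<close>, its matrix on the span of \<^term>\<open>e1 j\<close> and \<^term>\<open>e2 j\<close> is
  \<^term>\<open>pert_matrix (r j) (g j)\<close>.\<close>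
definition sym_op :: "(nat \<Rightarrow> real) \<Rightarrow> (nat \<Rightarrow> real) \<Rightarrow> real functional \<Rightarrow> real functional" where
  "sym_op r g v = (\<lambda>\<phi>\<in>Cinf. v (multT r g 1 \<phi>))"

lemma distributions_add:
  "v \<in> distributions \<Longrightarrow> f \<in> Cinf \<Longrightarrow> g \<in> Cinf \<Longrightarrow> v (\<lambda>p. f p + g p) = v f + v g"
  by (auto simp: distributions_def)

lemma distributions_cmult:
  "v \<in> distributions \<Longrightarrow> f \<in> Cinf \<Longrightarrow> v (\<lambda>p. c * f p) = c * v f"
  by (auto simp: distributions_def)

lemma distributions_bound:
  assumes "v \<in> distributions"
  obtains C N where "0 \<le> C" and "\<And>f. f \<in> Cinf \<Longrightarrow> norm (v f) \<le> C * Cinf_norm N f"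
proof -
  obtain C N where C: "\<And>f. f \<in> Cinf \<Longrightarrow> norm (v f) \<le> C * Cinf_norm N f"
    using assms unfolding distributions_def by blast
  show ?thesis
  proof (rule that[of "\<bar>C\<bar>" N])
    fix f :: "'a \<Rightarrow> complex" assume f: "f \<in> Cinf"
    have "C * Cinf_norm N f \<le> \<bar>C\<bar> * Cinf_norm N f"
      by (intro mult_right_mono Cinf_norm_nonneg f) auto
    with C[OF f] show "norm (v f) \<le> \<bar>C\<bar> * Cinf_norm N f" by linarith
  qed auto
qed

lemma mirror_real: "mirror (1::real) x = - x"
  by (simp add: mirror_def)

lemma conv_add:
  assumes "continuous_on UNIV K" "f1 \<in> Cinf" "f2 \<in> Cinf"
  shows "conv K b (\<lambda>p. f1 p + f2 p) p = conv K b f1 p + conv K b f2 p"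
  unfolding conv_def distrib_left
  by (intro integral_add conv_integrable assms(1) Cinf_continuous assms(2,3))

lemma conv_cmult: "conv K b (\<lambda>p. c * f p) p = c * conv K b f p"
proof -
  have "(\<lambda>y. K y * (c * f (p - y *\<^sub>R b))) = (\<lambda>y. c * (K y * f (p - y *\<^sub>R b)))"
    by (simp add: mult_ac)
  then show ?thesis by (simp add: conv_def)
qed

lemma multT_cmult: "multT r g b (\<lambda>p. c * f p) = (\<lambda>p. c * multT r g b f p)"
  by (simp add: multT_def conv_cmult algebra_simps)

lemma e1_fcoef: "f \<in> Cinf \<Longrightarrow> e1 j f = fcoef (- int j) f"
  by (simp add: e1_def dist_of_def fcoef_def)

lemma e2_fcoef: "f \<in> Cinf \<Longrightarrow> e2 j f = fcoef (int j) f"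
  by (simp add: e2_def dist_of_def fcoef_def)

context
  fixes r g :: "nat \<Rightarrow> real"
  assumes r: "summable (\<lambda>j. \<bar>r j\<bar>)" and g: "summable (\<lambda>j. \<bar>g j\<bar>)"
begin

lemma Cinf_multT: "f \<in> Cinf \<Longrightarrow> b \<in> Basis \<Longrightarrow> multT r g b f \<in> Cinf"
  unfolding multT_def
  by (intro Cinf_add Cinf_mirror Cinf_conv continuous_kern r g)

lemma multT_add:
  "f1 \<in> Cinf \<Longrightarrow> f2 \<in> Cinf \<Longrightarrow> multT r g b (\<lambda>p. f1 p + f2 p) = (\<lambda>p. multT r g b f1 p + multT r g b f2 p)"
  by (simp add: multT_def conv_add continuous_kern r g algebra_simps)

lemma sym_op_distributions:
  assumes v: "v \<in> distributions"
  shows "sym_op r g v \<in> distributions"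
proof -
  obtain C N where C: "0 \<le> C" "\<And>f. f \<in> Cinf \<Longrightarrow> norm (v f) \<le> C * Cinf_norm N f"
    using distributions_bound[OF v] by blast
  define M where "M h = 2 * pi * (\<Sum>j. \<bar>h j\<bar>)" for h :: "nat \<Rightarrow> real"
  have "norm (v (multT r g 1 f)) \<le> (C * (M r + M g)) * Cinf_norm N f" if f: "f \<in> Cinf" for f
  proof -
    have K: "conv (kern h) 1 f \<in> Cinf"
      and le: "Cinf_norm N (conv (kern h) 1 f) \<le> M h * Cinf_norm N f"
      if h: "summable (\<lambda>j. \<bar>h j\<bar>)" for h
      using Cinf_conv[OF continuous_kern[OF h] f] Cinf_norm_conv[OF continuous_kern[OF h] kern_bound[OF h] f]
      by (auto simp: M_def)
    have mir: "(\<lambda>p. conv (kern g) 1 f (mirror 1 p)) \<in> Cinf"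
      using Cinf_mirror[OF K[OF g], of 1] by simp
    have "norm (v (multT r g 1 f)) \<le>
        norm (v (conv (kern r) 1 f)) + norm (v (\<lambda>p. conv (kern g) 1 f (mirror 1 p)))"
      unfolding multT_def using distributions_add[OF v K[OF r] mir] by (simp add: norm_triangle_ineq)
    also have "\<dots> \<le> C * Cinf_norm N (conv (kern r) 1 f) +
        C * Cinf_norm N (\<lambda>p. conv (kern g) 1 f (mirror 1 p))"
      by (intro add_mono C mir K r)
    also have "\<dots> \<le> C * (M r * Cinf_norm N f) + C * (M g * Cinf_norm N f)"
      using Cinf_norm_mirror[OF K[OF g], of 1 N] le[OF r] le[OF g] C(1)
      by (intro add_mono mult_left_mono) auto
    finally show ?thesis by (simp add: algebra_simps)
  qed
  then show ?thesis
    unfolding distributions_def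
    using v by (auto simp: sym_op_def Cinf_add Cinf_cmult multT_add multT_cmult Cinf_multT
        distributions_add distributions_cmult intro!: exI)
qed

lemma dist_operator_sym_op: "dist_operator (sym_op r g)"
  unfolding dist_operator_def
  by (intro conjI ballI allI impI sym_op_distributions) (auto simp: sym_op_def Cinf_multT)

lemma fcoef_multT:
  assumes r0: "r 0 = 0" and g0: "g 0 = 0" and f: "f \<in> Cinf"
  shows "fcoef n (multT r g 1 f) =
    of_real (r (nat \<bar>n\<bar>)) * fcoef n f + of_real (g (nat \<bar>n\<bar>)) * fcoef (- n) f"
proof -
  have C: "conv (kern r) 1 f \<in> Cinf" "conv (kern g) 1 f \<in> Cinf"
    by (intro Cinf_conv continuous_kern r g f)+
  have "fcoef n (multT r g 1 f) = fcoef n (conv (kern r) 1 f) + fcoef n (\<lambda>x. conv (kern g) 1 f (- x))"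
    unfolding multT_def mirror_real
    by (intro fcoef_add Cinf_continuous C continuous_on_compose2[OF Cinf_continuous[OF C(2), of UNIV]]
        continuous_intros) auto
  also have "fcoef n (\<lambda>x. conv (kern g) 1 f (- x)) = fcoef (- n) (conv (kern g) 1 f)"
    using Cinf_periodic[OF C(2), of 1] by (intro fcoef_reflect Cinf_continuous C) auto
  finally show ?thesis
    by (simp add: fcoef_conv continuous_kern r g f fcoef_kern r0 g0)
qed

lemma perturbation_sym_op:
  assumes r0: "r 0 = 0" and g0: "g 0 = 0"
  shows "perturbation (sym_op r g)"
proof -
  have "sym_op r g (dist_of (\<lambda>_. 1)) f = 0" if f: "f \<in> Cinf" for f
  proof -
    have "sym_op r g (dist_of (\<lambda>_. 1)) f = fcoef 0 (multT r g 1 f)"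
      using f by (simp add: sym_op_def dist_of_def fcoef_def Cinf_multT)
    then show ?thesis by (simp add: fcoef_multT r0 g0 f)
  qed
  moreover have "sym_op r g (e1 j) f = of_real (r j) * e1 j f + of_real (g j) * e2 j f \<and>
      sym_op r g (e2 j) f = of_real (g j) * e1 j f + of_real (r j) * e2 j f" if f: "f \<in> Cinf" for f j
    using f by (simp add: sym_op_def Cinf_multT e1_fcoef e2_fcoef fcoef_multT r0 g0)
  moreover have "(\<lambda>j. onorm ((*v) (pert_matrix (r j) (g j)))) \<in> O(\<lambda>j. real j powr 0)"
  proof -
    have "Bseq r" "Bseq g"
      using summable_LIMSEQ_zero[OF summable_rabs_cancel[OF r]] summable_LIMSEQ_zero[OF summable_rabs_cancel[OF g]]
      by (auto intro: convergent_imp_Bseq convergentI)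
    then obtain A B where AB: "\<bar>r j\<bar> \<le> A" "\<bar>g j\<bar> \<le> B" for j
      unfolding Bseq_def by auto
    have "onorm ((*v) (pert_matrix (r j) (g j))) \<le> 4 * (A + B)" for j
    proof -
      have "\<bar>pert_matrix (r j) (g j) $ i $ k\<bar> \<le> A + B" for i k
        using exhaust_2[of i] exhaust_2[of k] AB[of j] by (auto simp: pert_matrix_def)
      then show ?thesis
        using onorm_le_matrix_component[of "pert_matrix (r j) (g j)" "A + B"] by simp
    qed
    moreover have "0 \<le> onorm ((*v) (pert_matrix (r j) (g j)))" for j
      by (intro onorm_pos_le matrix_vector_mul_bounded_linear)
    ultimately show ?thesis
      by (intro bigoI[of _ "4 * (A + B)"] eventually_mono[OF eventually_gt_at_top[of 0]]) auto
  qed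
  ultimately show ?thesis
    unfolding perturbation_def using dist_operator_sym_op by (intro conjI exI[of _ r] exI[of _ g] exI[of _ 0]) auto
qed

end

lemma dist_of_distributions:
  fixes F :: "'a::euclidean_space \<Rightarrow> complex"
  assumes F: "continuous_on UNIV F"
  shows "dist_of F \<in> distributions"
proof -
  let ?Q = "cbox 0 ((2 * pi) *\<^sub>R One) :: 'a set"
  have int: "(\<lambda>p. F p * f p) integrable_on ?Q" if "f \<in> Cinf" for f
    by (intro integrable_continuous continuous_intros continuous_on_subset[OF F] Cinf_continuous that) auto
  have "compact (F ` ?Q)"
    by (intro compact_continuous_image continuous_on_subset[OF F]) auto
  then obtain M where M: "M > 0" "\<And>p. p \<in> ?Q \<Longrightarrow> norm (F p) \<le> M"
    by (force dest!: compact_imp_bounded simp: bounded_pos)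
  have bound: "norm (integral ?Q (\<lambda>p. F p * f p)) \<le> (M * measure lborel ?Q) * Cinf_norm 0 f" if f: "f \<in> Cinf" for f
  proof -
    have "norm (integral ?Q (\<lambda>p. F p * f p)) \<le> (M * Cinf_norm 0 f) * measure lborel ?Q"
    proof (rule has_integral_bound[OF _ integrable_integral[OF int[OF f]]])
      show "norm (F p * f p) \<le> M * Cinf_norm 0 f" if "p \<in> ?Q" for p
        unfolding norm_mult Cinf_norm_0
        using M that by (intro mult_mono M(2) norm_le_SUP f) auto
    qed (use M Cinf_norm_nonneg[OF f] in auto)
    then show ?thesis by (simp add: mult_ac)
  qed
  have "integral ?Q (\<lambda>p. F p * (f p + g p)) = integral ?Q (\<lambda>p. F p * f p) + integral ?Q (\<lambda>p. F p * g p)"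
    if "f \<in> Cinf" "g \<in> Cinf" for f g
    using integral_add[OF int int] that by (simp add: distrib_left)
  moreover have "integral ?Q (\<lambda>p. F p * (c * f p)) = c * integral ?Q (\<lambda>p. F p * f p)" for c f
  proof -
    have "(\<lambda>p. F p * (c * f p)) = (\<lambda>p. c * (F p * f p))" by (simp add: mult_ac)
    then show ?thesis by simp
  qed
  ultimately show ?thesis
    unfolding distributions_def dist_of_def using bound
    by (intro CollectI conjI ballI allI exI[of _ "M * measure lborel ?Q"] exI[of _ "0 :: nat"])
       (simp_all add: Cinf_add Cinf_cmult)
qed

lemma conv_kern_0: "conv (kern (\<lambda>_. 0)) b f = (\<lambda>_. 0)"
  by (simp add: conv_def kern_def)

lemma commutative_sym_op:
  assumes r: "summable (\<lambda>j. \<bar>r j\<bar>)"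
  shows "commutative (sym_op r (\<lambda>_. 0))"
proof -
  have T: "multT r (\<lambda>_. 0) 1 f = conv (kern r) 1 f" for f :: "real \<Rightarrow> complex"
    by (simp add: multT_def conv_kern_0)
  have "D_op 1 (sym_op r (\<lambda>_. 0) v) = sym_op r (\<lambda>_. 0) (D_op 1 v)" for v
  proof
    fix f :: "real \<Rightarrow> complex"
    show "D_op 1 (sym_op r (\<lambda>_. 0) v) f = sym_op r (\<lambda>_. 0) (D_op 1 v) f"
    proof (cases "f \<in> Cinf")
      case True
      then have "(\<lambda>p. \<i> * partial_deriv 1 f p) \<in> Cinf" "conv (kern r) 1 f \<in> Cinf"
        by (auto intro!: Cinf_cmult Cinf_partial_deriv Cinf_conv continuous_kern r)
      moreover have "conv (kern r) 1 (\<lambda>p. \<i> * partial_deriv 1 f p) =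
          (\<lambda>p. \<i> * partial_deriv 1 (conv (kern r) 1 f) p)"
        using True by (subst partial_deriv_conv) (auto intro!: continuous_kern r simp: conv_cmult fun_eq_iff)
      ultimately show ?thesis
        using True by (simp add: D_op_def sym_op_def T)
    qed (simp add: D_op_def sym_op_def)
  qed
  then show ?thesis by (simp add: commutative_def)
qed

lemma Cinf_has_vector_derivative:
  fixes f :: "real \<Rightarrow> complex"
  assumes "f \<in> Cinf"
  shows "(f has_vector_derivative partial_deriv 1 f x) (at x)"
proof -
  have "linear (frechet_derivative f (at x))"
    using has_derivative_linear[OF Cinf_has_derivative[OF assms]] .
  then have "frechet_derivative f (at x) h = h *\<^sub>R partial_deriv 1 f x" for h
    using linear_scale[of "frechet_derivative f (at x)" h 1] by (simp add: partial_deriv_def)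
  then have "frechet_derivative f (at x) = (\<lambda>h. h *\<^sub>R partial_deriv 1 f x)" ..
  then show ?thesis
    unfolding has_vector_derivative_def using Cinf_has_derivative[OF assms, of x] by simp
qed

lemma fcoef_partial_deriv:
  assumes f: "f \<in> Cinf"
  shows "fcoef n (\<lambda>x. \<i> * partial_deriv 1 f x) = of_int n * fcoef n f"
  using Cinf_periodic[OF f, of 1 0]
  by (intro fcoef_deriv Cinf_has_vector_derivative[OF f] Cinf_continuous Cinf_partial_deriv f) auto

lemma Cinf_exp_real: "(\<lambda>x. exp (\<i> * of_int n * complex_of_real x)) \<in> Cinf"
  using Cinf_exp[of "of_int n :: real"] by (simp add: mult_ac)

text \<open>The failure is seen on \<^term>\<open>e1 1\<close>, which the operator maps to a combination of
  \<^term>\<open>e1 1\<close> and \<^term>\<open>e2 1\<close>, on which the derivative has different eigenvalues.\<close>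
lemma not_commutative_sym_op:
  assumes r: "summable (\<lambda>j. \<bar>r j\<bar>)" and g: "summable (\<lambda>j. \<bar>g j\<bar>)"
    and 0: "r 0 = 0" "g 0 = 0" and g1: "g 1 \<noteq> 0"
  shows "\<not> commutative (sym_op r g)"
proof
  assume comm: "commutative (sym_op r g)"
  define f where "f = (\<lambda>x. exp (\<i> * of_int (- 1) * complex_of_real x))"
  let ?T = "multT r g 1 :: (real \<Rightarrow> complex) \<Rightarrow> _"
  let ?D = "\<lambda>f :: real \<Rightarrow> complex. \<lambda>p. \<i> * partial_deriv 1 f p"
  have f: "f \<in> Cinf"
    unfolding f_def by (rule Cinf_exp_real)
  have Df: "?D f \<in> Cinf" and Tf: "?T f \<in> Cinf" and TDf: "?T (?D f) \<in> Cinf" and DTf: "?D (?T f) \<in> Cinf"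
    using f by (auto intro!: Cinf_multT r g Cinf_cmult Cinf_partial_deriv)
  have "e1 1 \<in> distributions"
    unfolding e1_def by (intro dist_of_distributions continuous_intros)
  then have "D_op 1 (sym_op r g (e1 1)) f = sym_op r g (D_op 1 (e1 1)) f"
    using comm by (simp add: commutative_def)
  then have "e1 1 (?T (?D f)) = e1 1 (?D (?T f))"
    using f Df Tf by (simp add: D_op_def sym_op_def)
  then have "fcoef (- 1) (?T (?D f)) = fcoef (- 1) (?D (?T f))"
    using e1_fcoef[OF TDf, of 1] e1_fcoef[OF DTf, of 1] by simp
  then have "of_real (g 1) * fcoef 1 f = 0"
    unfolding fcoef_partial_deriv[OF Tf]
    by (auto simp: fcoef_multT[OF r g 0] f Df fcoef_partial_deriv)
  moreover have "fcoef 1 f = 2 * pi"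
    unfolding f_def fcoef_exp by simp
  ultimately show False using g1 pi_gt_zero by auto
qed

section \<open>Fourier coefficients in two variables\<close>

text \<open>The Fourier coefficient on the two-dimensional torus at the character
  \<open>exp (\<i> (m t + n x))\<close>, again unnormalised and with a plus sign in the exponent.\<close>
definition fcoef2 :: "int \<Rightarrow> int \<Rightarrow> (real \<times> real \<Rightarrow> complex) \<Rightarrow> complex" where
  "fcoef2 m n f = integral (cbox 0 ((2 * pi) *\<^sub>R One))
     (\<lambda>p. exp (\<i> * of_real (p \<bullet> (of_int m, of_int n))) * f p)"

lemma exp_inner_prod:
  "exp (\<i> * of_real ((t, x) \<bullet> (of_int m, of_int n))) =
   exp (\<i> * of_int m * complex_of_real t) * exp (\<i> * of_int n * complex_of_real x)"
  by (simp add: algebra_simps flip: exp_add)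

lemma cbox_torus: "cbox 0 ((2 * pi) *\<^sub>R One) = cbox (0, 0) (2 * pi, 2 * pi :: real)"
proof -
  have "(One :: real \<times> real) = (1, 1)"
    by (simp only: sum_Basis_prod_eq) (simp add: prod_eq_iff fst_sum snd_sum)
  then show ?thesis by (simp add: zero_prod_def)
qed

lemma
  assumes f: "continuous_on UNIV f"
  shows fcoef2_iter1: "fcoef2 m n f = fcoef m (\<lambda>t. fcoef n (\<lambda>x. f (t, x)))"
    and fcoef2_iter2: "fcoef2 m n f = fcoef n (\<lambda>x. fcoef m (\<lambda>t. f (t, x)))"
proof -
  let ?F = "\<lambda>t x. exp (\<i> * of_real ((t, x) \<bullet> (of_int m, of_int n))) * f (t, x)"
  have cont: "continuous_on A (\<lambda>(t, x). ?F t x)" for A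
    unfolding split_def by (intro continuous_intros continuous_on_compose2[OF f]) auto
  have "fcoef2 m n f = integral (cbox (0, 0) (2 * pi, 2 * pi)) (\<lambda>(t, x). ?F t x)"
    by (simp only: fcoef2_def cbox_torus case_prod_unfold prod.collapse)
  also have "\<dots> = integral {0..2 * pi} (\<lambda>t. integral {0..2 * pi} (\<lambda>x. ?F t x))"
    by (subst integral_prod_continuous[OF cont]) (simp only: prod.case cbox_interval)
  finally have 1: "fcoef2 m n f = integral {0..2 * pi} (\<lambda>t. integral {0..2 * pi} (\<lambda>x. ?F t x))" .
  then show "fcoef2 m n f = fcoef m (\<lambda>t. fcoef n (\<lambda>x. f (t, x)))"
    by (simp add: fcoef_def exp_inner_prod mult.assoc del: inner_Pair)
  have "fcoef2 m n f = integral {0..2 * pi} (\<lambda>x. integral {0..2 * pi} (\<lambda>t. ?F t x))"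
    unfolding 1 cbox_interval[symmetric] by (rule integral_swap_continuous[OF cont])
  also have "\<dots> = fcoef n (\<lambda>x. fcoef m (\<lambda>t. f (t, x)))"
    unfolding fcoef_def exp_inner_prod integral_mult_right[symmetric] by (simp only: mult_ac)
  finally show "fcoef2 m n f = fcoef n (\<lambda>x. fcoef m (\<lambda>t. f (t, x)))" .
qed

lemma Basis_torus: "(1, 0) \<in> (Basis :: (real \<times> real) set)" "(0, 1) \<in> (Basis :: (real \<times> real) set)"
  by (auto simp: Basis_prod_def)

lemma Cinf_slice_derivative:
  fixes f :: "real \<times> real \<Rightarrow> complex"
  assumes f: "f \<in> Cinf"
  shows "((\<lambda>x. f (t, x)) has_vector_derivative partial_deriv (0, 1) f (t, x)) (at x)"
    and "((\<lambda>t. f (t, x)) has_vector_derivative partial_deriv (1, 0) f (t, x)) (at t)"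
proof -
  let ?f' = "frechet_derivative f (at (t, x))"
  have lin: "linear ?f'"
    using has_derivative_linear[OF Cinf_has_derivative[OF f]] .
  have "((\<lambda>x. (t, x)) has_derivative (\<lambda>h. (0, h))) (at x)"
    by (auto intro!: derivative_eq_intros)
  from has_derivative_compose[OF this Cinf_has_derivative[OF f]]
  have "((\<lambda>x. f (t, x)) has_derivative (\<lambda>h. ?f' (0, h))) (at x)" .
  moreover have "(\<lambda>h. ?f' (0, h)) = (\<lambda>h. h *\<^sub>R ?f' (0, 1))"
  proof
    show "?f' (0, h) = h *\<^sub>R ?f' (0, 1)" for h
      using linear_scale[OF lin, of h "(0, 1)"] by simp
  qed
  ultimately show "((\<lambda>x. f (t, x)) has_vector_derivative partial_deriv (0, 1) f (t, x)) (at x)"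
    by (simp only: has_vector_derivative_def partial_deriv_def)
  have "((\<lambda>t. (t, x)) has_derivative (\<lambda>h. (h, 0))) (at t)"
    by (auto intro!: derivative_eq_intros)
  from has_derivative_compose[OF this Cinf_has_derivative[OF f]]
  have "((\<lambda>t. f (t, x)) has_derivative (\<lambda>h. ?f' (h, 0))) (at t)" .
  moreover have "(\<lambda>h. ?f' (h, 0)) = (\<lambda>h. h *\<^sub>R ?f' (1, 0))"
  proof
    show "?f' (h, 0) = h *\<^sub>R ?f' (1, 0)" for h
      using linear_scale[OF lin, of h "(1, 0)"] by simp
  qed
  ultimately show "((\<lambda>t. f (t, x)) has_vector_derivative partial_deriv (1, 0) f (t, x)) (at t)"
    by (simp only: has_vector_derivative_def partial_deriv_def)
qed

lemma Cinf_slice: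
  fixes f :: "real \<times> real \<Rightarrow> complex"
  assumes f: "f \<in> Cinf"
  shows "(\<lambda>x. f (t, x)) \<in> Cinf"
proof (rule CinfI[where X="{\<lambda>x. f (t, x) | f. f \<in> Cinf}"], goal_cases)
  case 1
  then show ?case by (intro CollectI exI conjI) (rule refl, rule f)
next
  case (2 g b x)
  then show ?case using Cinf_periodic[OF _ Basis_torus(2), of _ "(t, x)"] by auto
next
  case (3 g x)
  then show ?case
    using Cinf_slice_derivative(1) by (auto simp: has_vector_derivative_def differentiable_def)
next
  case (4 g b)
  then obtain f where f: "g = (\<lambda>x. f (t, x))" "f \<in> Cinf" and b: "b = 1" by auto
  have "partial_deriv b g = (\<lambda>x. partial_deriv (0, 1) f (t, x))"
    using partial_deriv_eq[OF Cinf_slice_derivative(1)[OF f(2), unfolded has_vector_derivative_def]]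
    by (simp add: f(1) b)
  then show ?case using Cinf_partial_deriv[OF f(2) Basis_torus(2)] by blast
qed

lemma fcoef2_partial_deriv:
  assumes f: "f \<in> Cinf"
  shows "fcoef2 m n (\<lambda>p. \<i> * partial_deriv (1, 0) f p) = of_int m * fcoef2 m n f"
    and "fcoef2 m n (\<lambda>p. \<i> * partial_deriv (0, 1) f p) = of_int n * fcoef2 m n f"
proof -
  have cont: "continuous_on UNIV (\<lambda>x. partial_deriv c f (a x, b x))"
    if "c \<in> Basis" "continuous_on UNIV a" "continuous_on UNIV b" for c and a b :: "real \<Rightarrow> real"
    by (rule continuous_on_compose2[OF Cinf_continuous[OF Cinf_partial_deriv[OF f that(1)], of UNIV]
        continuous_on_Pair[OF that(2,3)]]) simp
  have cD: "continuous_on UNIV (\<lambda>p. \<i> * partial_deriv c f p)" if "c \<in> Basis" for c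
    by (intro Cinf_continuous Cinf_cmult Cinf_partial_deriv f that)
  have "fcoef m (\<lambda>t. \<i> * partial_deriv (1, 0) f (t, x)) = of_int m * fcoef m (\<lambda>t. f (t, x))" for x
    using Cinf_periodic[OF f Basis_torus(1), of "(0, x)"]
    by (intro fcoef_deriv Cinf_slice_derivative(2) f cont Basis_torus continuous_intros) auto
  then show "fcoef2 m n (\<lambda>p. \<i> * partial_deriv (1, 0) f p) = of_int m * fcoef2 m n f"
    by (simp add: fcoef2_iter2 cD Basis_torus Cinf_continuous f fcoef_cmult)
  have "fcoef n (\<lambda>x. \<i> * partial_deriv (0, 1) f (t, x)) = of_int n * fcoef n (\<lambda>x. f (t, x))" for t
    using Cinf_periodic[OF f Basis_torus(2), of "(t, 0)"]
    by (intro fcoef_deriv Cinf_slice_derivative(1) f cont Basis_torus continuous_intros) auto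
  then show "fcoef2 m n (\<lambda>p. \<i> * partial_deriv (0, 1) f p) = of_int n * fcoef2 m n f"
    by (simp add: fcoef2_iter1 cD Basis_torus Cinf_continuous f fcoef_cmult)
qed

text \<open>Acting in the direction \<open>(0, 1)\<close> is the same as acting on the functions of \<open>x\<close> with \<open>t\<close> fixed.\<close>
lemma multT_slice: "multT r g 1 (\<lambda>y. f (t, y)) x = multT r g (0, 1) f (t, x)"
  by (simp add: multT_def conv_def mirror_def)

lemma fcoef2_multT:
  assumes r: "summable (\<lambda>j. \<bar>r j\<bar>)" and g: "summable (\<lambda>j. \<bar>g j\<bar>)"
    and 0: "r 0 = 0" "g 0 = 0" and gn: "g (nat \<bar>n\<bar>) = 0" and f: "f \<in> Cinf"
  shows "fcoef2 m n (multT r g (0, 1) f) = of_real (r (nat \<bar>n\<bar>)) * fcoef2 m n f"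
proof -
  have "fcoef n (\<lambda>x. multT r g (0, 1) f (t, x)) = of_real (r (nat \<bar>n\<bar>)) * fcoef n (\<lambda>x. f (t, x))" for t
    using fcoef_multT[OF r g 0 Cinf_slice[OF f], of n t]
    unfolding multT_slice[symmetric] by (simp add: gn)
  then show ?thesis
    by (simp add: fcoef2_iter1 Cinf_continuous Cinf_multT r g f Basis_torus fcoef_cmult)
qed

lemma act_in_x_sym_op:
  assumes r: "summable (\<lambda>j. \<bar>r j\<bar>)" and g: "summable (\<lambda>j. \<bar>g j\<bar>)" and f: "f \<in> Cinf"
  shows "act_in_x (sym_op r g) u f = u (multT r g (0, 1) f)"
proof -
  have "transpose_op (sym_op r g) (\<lambda>y. f (t, y)) x = multT r g (0, 1) f (t, x)" for t x
    by (simp add: transpose_op_def sym_op_def dirac_def Cinf_slice f Cinf_multT r g multT_slice)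
  then show ?thesis by (simp add: act_in_x_def f case_prod_unfold)
qed

section \<open>Failure of global hypoellipticity\<close>

lemma norm_exp_inner: "norm (exp (\<i> * of_real (p \<bullet> a))) = 1"
  by simp

lemma fcoef2_exp:
  "fcoef2 m n (\<lambda>p. exp (\<i> * of_real (p \<bullet> (of_int m', of_int n')))) =
    (if m = - m' \<and> n = - n' then (2 * pi)\<^sup>2 else 0)"
proof -
  have "continuous_on UNIV (\<lambda>p :: real \<times> real. exp (\<i> * of_real (p \<bullet> (of_int m', of_int n'))))"
    by (intro continuous_intros)
  from fcoef2_iter1[OF this, of m n]
  have "fcoef2 m n (\<lambda>p. exp (\<i> * of_real (p \<bullet> (of_int m', of_int n')))) =
      fcoef m (\<lambda>t. fcoef n (\<lambda>x. exp (\<i> * of_int m' * of_real t) * exp (\<i> * of_int n' * of_real x)))"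
    unfolding exp_inner_prod .
  also have "\<dots> = fcoef m (\<lambda>t. fcoef n (\<lambda>x. exp (\<i> * of_int n' * of_real x)) * exp (\<i> * of_int m' * of_real t))"
    by (simp only: fcoef_cmult mult.commute)
  also have "\<dots> = (if m = - m' \<and> n = - n' then (2 * pi)\<^sup>2 else 0)"
    unfolding fcoef_cmult fcoef_exp by (simp add: power2_eq_square)
  finally show ?thesis .
qed

lemma Cinf_exp_prod: "(\<lambda>p. exp (\<i> * of_real (p \<bullet> (of_int m :: real, of_int n :: real)))) \<in> Cinf"
  by (intro Cinf_exp) (auto simp: Basis_prod_def)

lemma norm_fcoef2_le:
  assumes f: "f \<in> Cinf"
  shows "norm (fcoef2 m n f) \<le> (SUP p. norm (f p)) * measure lborel (cbox 0 ((2 * pi) *\<^sub>R One :: real \<times> real))"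
  unfolding fcoef2_def
proof (rule has_integral_bound[OF SUP_norm_nonneg[OF f] integrable_integral])
  show "(\<lambda>p. exp (\<i> * of_real (p \<bullet> (of_int m, of_int n))) * f p) integrable_on cbox 0 ((2 * pi) *\<^sub>R One)"
    by (intro integrable_continuous continuous_intros Cinf_continuous f)
  show "norm (exp (\<i> * of_real (p \<bullet> (of_int m, of_int n))) * f p) \<le> (SUP p. norm (f p))" for p
    unfolding norm_mult norm_exp_inner using norm_le_SUP[OF f] by simp
qed

text \<open>One integration by parts in \<open>x\<close>.\<close>
lemma fcoef2_decay:
  assumes f: "f \<in> Cinf"
  obtains B where "\<And>m n. \<bar>of_int n\<bar> * norm (fcoef2 m n f) \<le> B"
proof -
  let ?Df = "\<lambda>p. \<i> * partial_deriv (0, 1) f p"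
  have D: "?Df \<in> Cinf"
    by (intro Cinf_cmult Cinf_partial_deriv f Basis_torus)
  have "\<bar>of_int n\<bar> * norm (fcoef2 m n f) = norm (fcoef2 m n ?Df)" for m n
    by (simp add: fcoef2_partial_deriv(2)[OF f] norm_mult)
  then show ?thesis
    using norm_fcoef2_le[OF D] by (intro that) (simp only:)
qed

lemma dist_of_exp_series:
  fixes c :: "nat \<Rightarrow> real" and \<tau> \<xi> :: "nat \<Rightarrow> int"
  assumes c: "summable (\<lambda>j. \<bar>c j\<bar>)"
  defines "F \<equiv> \<lambda>p. \<Sum>j. of_real (c j) * exp (\<i> * of_real (p \<bullet> (of_int (\<tau> j), of_int (\<xi> j))))"
  shows "dist_of F \<in> distributions"
    and "f \<in> Cinf \<Longrightarrow> (\<lambda>j. of_real (c j) * fcoef2 (\<tau> j) (\<xi> j) f) sums dist_of F f"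
proof -
  let ?e = "\<lambda>j p. complex_of_real (c j) * exp (\<i> * of_real (p \<bullet> (of_int (\<tau> j), of_int (\<xi> j))))"
  let ?Q = "cbox 0 ((2 * pi) *\<^sub>R One) :: (real \<times> real) set"
  have cont: "continuous_on A (?e j)" for A j
    by (intro continuous_intros)
  have bound: "norm (?e j p) \<le> \<bar>c j\<bar>" for j p
    unfolding norm_mult norm_exp_inner by simp
  show "dist_of F \<in> distributions"
    unfolding F_def
    by (rule dist_of_distributions, rule continuous_suminf[where M="\<lambda>j. \<bar>c j\<bar>"]) (intro cont bound c)+
  assume f: "f \<in> Cinf"
  have "(\<lambda>j. integral ?Q (\<lambda>p. ?e j p * f p)) sums integral ?Q (\<lambda>p. \<Sum>j. ?e j p * f p)"
  proof (rule sums_integral_suminf)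
    show "continuous_on UNIV (\<lambda>p. ?e j p * f p)" for j
      by (intro continuous_on_mult cont Cinf_continuous f)
    show "norm (?e j p * f p) \<le> \<bar>c j\<bar> * (SUP p. norm (f p))" for j p
      unfolding norm_mult[of "?e j p"] by (intro mult_mono bound norm_le_SUP f) auto
    show "summable (\<lambda>j. \<bar>c j\<bar> * (SUP p. norm (f p)))"
      by (rule summable_mult2[OF c])
  qed
  moreover have "(\<Sum>j. ?e j p * f p) = F p * f p" for p
    unfolding F_def
    by (rule suminf_mult2[symmetric, OF summable_comparison_test'[OF c bound]])
  moreover have "integral ?Q (\<lambda>p. ?e j p * f p) = of_real (c j) * fcoef2 (\<tau> j) (\<xi> j) f" for j
    by (simp add: fcoef2_def mult.assoc)
  ultimately show "(\<lambda>j. of_real (c j) * fcoef2 (\<tau> j) (\<xi> j) f) sums dist_of F f"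
    using f by (simp add: dist_of_def)
qed

lemma Cinf_zero: "(\<lambda>_ :: real \<times> real. 0) \<in> Cinf"
  using Cinf_cmult[OF Cinf_exp_prod, of 0] by simp

text \<open>The distribution given by \<open>\<Sum> c j * exp (\<i> (\<tau> j t + j x))\<close> is annihilated term by term, by the
  resonance condition, but its coefficients decay too slowly for a smooth function.\<close>
lemma not_globally_hypoelliptic_sym_op:
  fixes c r g :: "nat \<Rightarrow> real" and \<tau> :: "nat \<Rightarrow> int"
  assumes r: "summable (\<lambda>j. \<bar>r j\<bar>)" and g: "summable (\<lambda>j. \<bar>g j\<bar>)"
    and 0: "r 0 = 0" "g 0 = 0"
    and c: "summable (\<lambda>j. \<bar>c j\<bar>)"
    and resonance: "\<And>j. c j \<noteq> 0 \<Longrightarrow> g j = 0 \<and> of_int (\<tau> j) + \<alpha> * of_nat j + r j = 0"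
    and unbounded: "\<And>B. \<exists>j. B < of_nat j * \<bar>c j\<bar>"
  shows "\<not> globally_hypoelliptic (L_op \<alpha> (sym_op r g))"
proof
  assume GH: "globally_hypoelliptic (L_op \<alpha> (sym_op r g))"
  define F where "F = (\<lambda>p :: real \<times> real. \<Sum>j. of_real (c j) * exp (\<i> * of_real (p \<bullet> (of_int (\<tau> j), of_int (int j)))))"
  define u where "u = dist_of F"
  have u: "u \<in> distributions"
    and u_sums: "\<And>f. f \<in> Cinf \<Longrightarrow> (\<lambda>j. of_real (c j) * fcoef2 (\<tau> j) (int j) f) sums u f"
    using dist_of_exp_series[OF c, where \<tau>=\<tau> and \<xi>=int] unfolding u_def F_def by blast+
  have "L_op \<alpha> (sym_op r g) u f = 0" if f: "f \<in> Cinf" for f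
  proof -
    let ?h = "\<lambda>j. complex_of_real (c j) * fcoef2 (\<tau> j) (int j) f"
    have t: "(\<lambda>p. \<i> * partial_deriv (1, 0) f p) \<in> Cinf" and x: "(\<lambda>p. \<i> * partial_deriv (0, 1) f p) \<in> Cinf"
      and T: "multT r g (0, 1) f \<in> Cinf"
      by (intro Cinf_cmult Cinf_partial_deriv Cinf_multT f r g Basis_torus)+
    have "(\<lambda>j. of_real (c j) * (of_int (\<tau> j) * fcoef2 (\<tau> j) (int j) f)) sums D_op (1, 0) u f"
      using u_sums[OF t] f by (simp add: D_op_def fcoef2_partial_deriv)
    moreover have "(\<lambda>j. of_real \<alpha> * (of_real (c j) * (of_nat j * fcoef2 (\<tau> j) (int j) f))) sums
        (of_real \<alpha> * D_op (0, 1) u f)"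
      using sums_mult[OF u_sums[OF x], of "of_real \<alpha>"] f by (simp add: D_op_def fcoef2_partial_deriv)
    moreover have "(\<lambda>j. of_real (c j) * (of_real (r j) * fcoef2 (\<tau> j) (int j) f)) sums act_in_x (sym_op r g) u f"
    proof -
      have "of_real (c j) * fcoef2 (\<tau> j) (int j) (multT r g (0, 1) f) =
          of_real (c j) * (of_real (r j) * fcoef2 (\<tau> j) (int j) f)" for j
        using fcoef2_multT[OF r g 0 _ f, of "int j"] resonance[of j] by (cases "c j = 0") auto
      then show ?thesis
        using u_sums[OF T] unfolding act_in_x_sym_op[OF r g f] by (simp only:)
    qed
    ultimately have "(\<lambda>j. of_real (c j) * (of_int (\<tau> j) * fcoef2 (\<tau> j) (int j) f) +
        of_real \<alpha> * (of_real (c j) * (of_nat j * fcoef2 (\<tau> j) (int j) f)) +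
        of_real (c j) * (of_real (r j) * fcoef2 (\<tau> j) (int j) f)) sums L_op \<alpha> (sym_op r g) u f"
      using f unfolding L_op_def by (simp add: sums_add)
    moreover have "of_real (c j) * (of_int (\<tau> j) * fcoef2 (\<tau> j) (int j) f) +
        of_real \<alpha> * (of_real (c j) * (of_nat j * fcoef2 (\<tau> j) (int j) f)) +
        of_real (c j) * (of_real (r j) * fcoef2 (\<tau> j) (int j) f) = 0" for j
    proof -
      have "of_real (c j) * (of_int (\<tau> j) * fcoef2 (\<tau> j) (int j) f) +
          of_real \<alpha> * (of_real (c j) * (of_nat j * fcoef2 (\<tau> j) (int j) f)) +
          of_real (c j) * (of_real (r j) * fcoef2 (\<tau> j) (int j) f) =
          of_real (c j * (of_int (\<tau> j) + \<alpha> * of_nat j + r j)) * fcoef2 (\<tau> j) (int j) f"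
        by (simp add: algebra_simps)
      then show ?thesis using resonance[of j] by (cases "c j = 0") auto
    qed
    ultimately have "(\<lambda>j. 0) sums L_op \<alpha> (sym_op r g) u f" by simp
    then show ?thesis using sums_0 sums_unique2 by blast
  qed
  then have "L_op \<alpha> (sym_op r g) u = dist_of (\<lambda>_. 0)"
    by (auto simp: L_op_def dist_of_def)
  then have "u \<in> dist_of ` Cinf"
    using GH u Cinf_zero unfolding globally_hypoelliptic_def by blast
  then obtain G where G: "G \<in> Cinf" "u = dist_of G" by blast
  obtain B where B: "\<bar>of_int n\<bar> * norm (fcoef2 m n G) \<le> B" for m n
    using fcoef2_decay[OF G(1)] by blast
  \<comment> \<open>Testing \<open>G\<close> against the characters recovers the coefficients \<open>c\<close>.\<close>
  have "of_nat j * \<bar>c j\<bar> \<le> B / (2 * pi)\<^sup>2" for j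
  proof -
    let ?e = "\<lambda>p :: real \<times> real. exp (\<i> * of_real (p \<bullet> (of_int (- \<tau> j), of_int (- int j))))"
    have e: "?e \<in> Cinf" by (rule Cinf_exp_prod)
    have "of_real (c i) * fcoef2 (\<tau> i) (int i) ?e = (if i = j then of_real (c i * (2 * pi)\<^sup>2) else 0)" for i
      unfolding fcoef2_exp by auto
    then have "(\<lambda>i. if i = j then complex_of_real (c i * (2 * pi)\<^sup>2) else 0) sums u ?e"
      using u_sums[OF e] by simp
    then have "u ?e = of_real (c j * (2 * pi)\<^sup>2)"
      using sums_single[of j "\<lambda>i. complex_of_real (c i * (2 * pi)\<^sup>2)"] sums_unique2 by blast
    moreover have "u ?e = fcoef2 (- \<tau> j) (- int j) G"
      using e by (simp add: G(2) dist_of_def fcoef2_def mult.commute)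
    ultimately have "norm (fcoef2 (- \<tau> j) (- int j) G) = \<bar>c j\<bar> * (2 * pi)\<^sup>2"
      by (metis abs_mult abs_power2 norm_of_real real_norm_def)
    with B[of "- int j" "- \<tau> j"] have "of_nat j * (\<bar>c j\<bar> * (2 * pi)\<^sup>2) \<le> B" by simp
    then show ?thesis by (simp add: pos_le_divide_eq mult.assoc)
  qed
  with unbounded[of "B / (2 * pi)\<^sup>2"] show False by (meson not_less)
qed

section \<open>Sparse approximation by integers\<close>

text \<open>Dirichlet's theorem gives a positive \<open>k\<close> of unspecified size; multiplying it by \<open>Suc N\<close> makes
  it large and spoils the approximation by the factor \<open>Suc N\<close> only.\<close>
lemma arbitrarily_large_approx:
  fixes \<alpha> \<epsilon> :: real and N :: nat
  assumes "0 < \<epsilon>"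
  shows "\<exists>j\<ge>N. \<bar>\<alpha> * of_nat j - of_int (round (\<alpha> * of_nat j))\<bar> \<le> \<epsilon>"
proof -
  define M where "M = nat \<lceil>of_nat (Suc N) / \<epsilon>\<rceil> + 1"
  have M: "0 < M" "of_nat (Suc N) / \<epsilon> \<le> of_nat M"
    unfolding M_def by linarith+
  obtain h k where hk: "0 < k" "\<bar>of_int k * \<alpha> - of_int h\<bar> < 1 / of_nat M"
    using Dirichlet_approx[OF M(1), of \<alpha>] by blast
  define j where "j = Suc N * nat k"
  have "of_nat j = of_nat (Suc N) * (of_int k :: real)"
    unfolding j_def of_nat_mult using hk(1) by simp
  then have "\<alpha> * of_nat j - of_int (int (Suc N) * h) = of_nat (Suc N) * (of_int k * \<alpha> - of_int h)"
    by (simp add: algebra_simps)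
  then have "\<bar>\<alpha> * of_nat j - of_int (int (Suc N) * h)\<bar> = of_nat (Suc N) * \<bar>of_int k * \<alpha> - of_int h\<bar>"
    by (simp add: abs_mult del: of_nat_Suc)
  also have "\<dots> \<le> of_nat (Suc N) * (1 / of_nat M)"
    using hk(2) by (intro mult_left_mono) auto
  also have "\<dots> \<le> \<epsilon>"
    using M assms by (simp add: field_simps del: of_nat_Suc)
  finally have "\<bar>\<alpha> * of_nat j - of_int (round (\<alpha> * of_nat j))\<bar> \<le> \<epsilon>"
    using round_diff_minimal order_trans by blast
  moreover have "N \<le> j"
    using hk(1) by (cases "nat k") (auto simp: j_def)
  ultimately show ?thesis by blast
qed

lemma sparse_approx:
  fixes \<alpha> :: real
  obtains m :: "nat \<Rightarrow> nat" where "strict_mono m"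
    and "\<And>k. 4 ^ Suc k \<le> m k"
    and "\<And>k. \<bar>\<alpha> * of_nat (m k) - of_int (round (\<alpha> * of_nat (m k)))\<bar> \<le> (1 / 2) ^ k"
proof -
  let ?P = "\<lambda>k j. 4 ^ Suc k \<le> j \<and> \<bar>\<alpha> * of_nat j - of_int (round (\<alpha> * of_nat j))\<bar> \<le> (1 / 2) ^ k"
  have ex: "\<exists>j. ?P k j \<and> i < j" for k i
    using arbitrarily_large_approx[of "(1 / 2) ^ k" "max (4 ^ Suc k) (Suc i)" \<alpha>] by auto
  then have "\<exists>m. \<forall>k. ?P k (m k) \<and> m k < m (Suc k)"
    by (intro dependent_nat_choice) blast+
  then obtain m where "\<And>k. ?P k (m k) \<and> m k < m (Suc k)" by blast
  then show ?thesis
    by (intro that[of m]) (auto simp: strict_mono_Suc_iff)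
qed

section \<open>The two perturbations\<close>

theorem theorem4p5:
  fixes \<alpha> :: real
  assumes "\<alpha> \<notin> \<rat>"
  shows "\<exists>S R. perturbation S \<and> commutative S \<and>
           perturbation R \<and> \<not> commutative R \<and>
           \<not> globally_hypoelliptic (L_op \<alpha> S) \<and>
           \<not> globally_hypoelliptic (L_op \<alpha> R)"
proof -
  obtain m :: "nat \<Rightarrow> nat" where mono: "strict_mono m"
    and m4: "\<And>k. 4 ^ Suc k \<le> m k"
    and approx: "\<And>k. \<bar>\<alpha> * of_nat (m k) - of_int (round (\<alpha> * of_nat (m k)))\<bar> \<le> (1 / 2) ^ k"
    using sparse_approx[of \<alpha>] by blast
  define r where "r j = (if j \<in> range m then of_int (round (\<alpha> * of_nat j)) - \<alpha> * of_nat j else 0)" for j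
  define c where "c j = (if j \<in> range m then 1 / sqrt (of_nat j) else 0)" for j
  define \<tau> where "\<tau> j = - round (\<alpha> * of_nat j)" for j :: nat
  define g where "g j = (if j = 1 then 1 else 0 :: real)" for j :: nat
  have geometric: "summable (\<lambda>k. (1 / 2 :: real) ^ k)"
    by (rule summable_geometric) simp
  have "1 < m k" for k
    using m4[of k] one_le_power[of "4 :: nat" k] unfolding power_Suc by linarith
  then have small: "0 \<notin> range m" "1 \<notin> range m"
    by (metis imageE less_irrefl not_less_zero)+
  have r: "summable (\<lambda>j. \<bar>r j\<bar>)"
  proof (subst summable_mono_reindex[OF mono, symmetric])
    have "\<bar>r (m k)\<bar> \<le> (1 / 2) ^ k" for k
      using approx[of k] by (simp add: r_def abs_minus_commute)
    then show "summable (\<lambda>k. \<bar>r (m k)\<bar>)"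
      by (intro summable_comparison_test'[OF geometric]) auto
  qed (simp add: r_def)
  have sqrt_m: "2 ^ k \<le> sqrt (of_nat (m k))" for k
  proof (rule real_le_rsqrt)
    have "(2 ^ k)\<^sup>2 = (of_nat (4 ^ k) :: real)"
      by (simp add: power2_eq_square flip: power_mult_distrib)
    also have "\<dots> \<le> of_nat (m k)"
      using m4[of k] by (intro of_nat_mono) simp
    finally show "(2 ^ k)\<^sup>2 \<le> real (m k)" .
  qed
  have c: "summable (\<lambda>j. \<bar>c j\<bar>)"
  proof (subst summable_mono_reindex[OF mono, symmetric])
    have "\<bar>c (m k)\<bar> \<le> (1 / 2) ^ k" for k
      using sqrt_m[of k] by (simp add: c_def power_divide frac_le)
    then show "summable (\<lambda>k. \<bar>c (m k)\<bar>)"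
      by (intro summable_comparison_test'[OF geometric]) auto
  qed (simp add: c_def)
  have unbounded: "\<exists>j. B < of_nat j * \<bar>c j\<bar>" for B
  proof -
    obtain k where "B < 2 ^ k"
      using real_arch_pow[of 2 B] by auto
    also have "2 ^ k \<le> sqrt (of_nat (m k))"
      by (rule sqrt_m)
    also have "\<dots> = of_nat (m k) * \<bar>c (m k)\<bar>"
      by (simp add: c_def real_div_sqrt)
    finally show ?thesis by blast
  qed
  have g: "summable (\<lambda>j. \<bar>g j\<bar>)"
    by (rule summable_finite[of "{1}"]) (auto simp: g_def)
  have zero: "summable (\<lambda>_::nat. \<bar>0 :: real\<bar>)"
    by simp
  have r0: "r 0 = 0" and g0: "g 0 = 0" and g1: "g 1 \<noteq> 0"
    using small by (auto simp: r_def g_def)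
  have resonance: "g j = 0 \<and> of_int (\<tau> j) + \<alpha> * of_nat j + r j = 0" if "c j \<noteq> 0" for j
  proof -
    have "j \<in> range m"
      using that by (auto simp: c_def split: if_splits)
    moreover from this have "j \<noteq> 1"
      using small(2) by metis
    ultimately show ?thesis
      by (simp add: g_def r_def \<tau>_def)
  qed
  have "perturbation (sym_op r (\<lambda>_. 0)) \<and> commutative (sym_op r (\<lambda>_. 0)) \<and>
      perturbation (sym_op r g) \<and> \<not> commutative (sym_op r g) \<and>
      \<not> globally_hypoelliptic (L_op \<alpha> (sym_op r (\<lambda>_. 0))) \<and>
      \<not> globally_hypoelliptic (L_op \<alpha> (sym_op r g))"
    using perturbation_sym_op[OF r zero] perturbation_sym_op[OF r g] commutative_sym_op[OF r]
      not_commutative_sym_op[OF r g r0 g0 g1]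
      not_globally_hypoelliptic_sym_op[OF r zero r0 _ c _ unbounded, of \<tau> \<alpha>]
      not_globally_hypoelliptic_sym_op[OF r g r0 g0 c resonance unbounded]
      resonance r0 g0
    by auto
  then show ?thesis by blast
qed

end
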